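(* Fix a nonzero integer $r$. Let $K_1,K_2,\ldots$ be a sequence of fields, where each $K_i$ is a finite extension of $\mathbb{Q}_{p_i}$ for some prime $p_i$, and suppose $p_i\to\infty$ as $i\to\infty$. Let $\mathcal{O}_{K_i}$ be the valuation ring of $K_i$, equipped with its Haar measure normalized so that $\mathcal{O}_{K_i}$ has measure $1$, and let $$\mathrm{diop}_3^r(\mathcal{O}_{K_i})=\mu\left(\{(a,b,c)\in\mathcal{O}_{K_i}^3 : ab+r,\ bc+r,\ ac+r\in\square(\mathcal{O}_{K_i})\}\right)$$ with $\mu$ the product measure. Then as $i\to\infty$, $$\mathrm{diop}_3^r(\mathcal{O}_{K_i})=\frac18+O\!\left(\frac{1}{p_i}\right),$$ i.e. there is a constant $C$ (depending on $r$) such that $\left|\mathrm{diop}_3^r(\mathcal{O}_{K_i})-\frac18\right|\le C/p_i$ for all sufficiently large $i$.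
   Context: $\square(R)=\{x^2:x\in R\}$ denotes the set of squares in a ring $R$; $r$ is viewed in $\mathcal{O}_{K_i}$ via $\mathbb{Z}\subset\mathbb{Z}_{p_i}\subseteq\mathcal{O}_{K_i}$. *)

theory Defs
  imports "HOL-Algebra.Embedded_Algebras" "HOL-Algebra.QuotRing" "HOL-Analysis.Analysis"
    "HOL-Computational_Algebra.Primes"
begin

section \<open>The field of p-adic numbers as the completion of the rationals\<close>

text \<open>For a reduced fraction \<open>x = a / b\<close>, the exponent is \<open>- v\<^sub>p(x) = v\<^sub>p(b) - v\<^sub>p(a)\<close>.\<close>

definition padic_abs :: "nat \<Rightarrow> rat \<Rightarrow> real" where
  "padic_abs p x =
     (if x = 0 then 0
      else (case quotient_of x of (a, b) \<Rightarrow>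
        real p powi (int (multiplicity (int p) b) - int (multiplicity (int p) a))))"

definition padic_Cauchy_seqs :: "nat \<Rightarrow> (nat \<Rightarrow> rat) set" where
  "padic_Cauchy_seqs p =
     {X. \<forall>e>0. \<exists>N. \<forall>m\<ge>N. \<forall>n\<ge>N. padic_abs p (X m - X n) < e}"

definition padic_Cauchy_ring :: "nat \<Rightarrow> (nat \<Rightarrow> rat) ring" where
  "padic_Cauchy_ring p =
     \<lparr>carrier = padic_Cauchy_seqs p,
      monoid.mult = (\<lambda>X Y n. X n * Y n), one = (\<lambda>n. 1),
      zero = (\<lambda>n. 0), add = (\<lambda>X Y n. X n + Y n)\<rparr>"

definition padic_null_seqs :: "nat \<Rightarrow> (nat \<Rightarrow> rat) set" where
  "padic_null_seqs p = {X. (\<lambda>n. padic_abs p (X n)) \<longlonglongrightarrow> 0}"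

definition Qp :: "nat \<Rightarrow> (nat \<Rightarrow> rat) set ring" where
  "Qp p = padic_Cauchy_ring p Quot padic_null_seqs p"

text \<open>The limit below exists and is the same for all representatives of a class.\<close>

definition Qp_abs :: "nat \<Rightarrow> (nat \<Rightarrow> rat) set \<Rightarrow> real" where
  "Qp_abs p A = (THE l. \<forall>X\<in>A. (\<lambda>n. padic_abs p (X n)) \<longlonglongrightarrow> l)"


section \<open>Finite extensions of the p-adic numbers and their valuation rings\<close>

locale finite_extension_of_Qp = field K for K :: "('a, 'b) ring_scheme" (structure) +
  fixes p :: nat and \<phi> :: "(nat \<Rightarrow> rat) set \<Rightarrow> 'a"
  assumes prime_p: "prime p"
    and embedding: "\<phi> \<in> ring_hom (Qp p) K"
    and finite_degree: "finite_dimension (\<phi> ` carrier (Qp p)) (carrier K)"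

text \<open>
  The non-archimedean absolute value \<open>v\<close> extending the one of \<open>Qp p\<close> exists and is unique
  (on the carrier); it is carried along as part of the data of a p-adic field.
\<close>

locale padic_field = finite_extension_of_Qp K p \<phi>
  for K :: "('a, 'b) ring_scheme" (structure) and p :: nat
    and \<phi> :: "(nat \<Rightarrow> rat) set \<Rightarrow> 'a" +
  fixes v :: "'a \<Rightarrow> real"
  assumes v_nonneg: "x \<in> carrier K \<Longrightarrow> 0 \<le> v x"
    and v_eq_0_iff: "x \<in> carrier K \<Longrightarrow> v x = 0 \<longleftrightarrow> x = \<zero>"
    and v_mult: "\<lbrakk>x \<in> carrier K; y \<in> carrier K\<rbrakk> \<Longrightarrow> v (x \<otimes> y) = v x * v y"
    and v_add: "\<lbrakk>x \<in> carrier K; y \<in> carrier K\<rbrakk> \<Longrightarrow> v (x \<oplus> y) \<le> max (v x) (v y)"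
    and v_extends: "A \<in> carrier (Qp p) \<Longrightarrow> v (\<phi> A) = Qp_abs p A"

definition valuation_ring :: "('a, 'b) ring_scheme \<Rightarrow> ('a \<Rightarrow> real) \<Rightarrow> ('a, 'b) ring_scheme" where
  "valuation_ring K v = K\<lparr>carrier := {x \<in> carrier K. v x \<le> 1}\<rparr>"


section \<open>Normalized Haar measure\<close>

definition valuation_open :: "('a, 'b) ring_scheme \<Rightarrow> ('a \<Rightarrow> real) \<Rightarrow> 'a set \<Rightarrow> bool" where
  "valuation_open R v U \<longleftrightarrow>
     U \<subseteq> carrier R \<and>
     (\<forall>x\<in>U. \<exists>e>0. \<forall>y\<in>carrier R. v (y \<ominus>\<^bsub>R\<^esub> x) < e \<longrightarrow> y \<in> U)"

text \<open>
  Translation-invariant Borel probability measure on the additive group of \<open>R\<close>. The valuation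
  rings considered here are compact metrizable groups, so regularity is automatic.
\<close>

definition normalized_Haar_measure ::
  "('a, 'b) ring_scheme \<Rightarrow> ('a \<Rightarrow> real) \<Rightarrow> 'a measure \<Rightarrow> bool" where
  "normalized_Haar_measure R v M \<longleftrightarrow>
     space M = carrier R \<and>
     sets M = sigma_sets (carrier R) {U. valuation_open R v U} \<and>
     emeasure M (carrier R) = 1 \<and>
     (\<forall>a\<in>carrier R. \<forall>S\<in>sets M. emeasure M ((\<lambda>x. a \<oplus>\<^bsub>R\<^esub> x) ` S) = emeasure M S)"


section \<open>Diophantine triples\<close>

definition squares :: "('a, 'b) ring_scheme \<Rightarrow> 'a set" where
  "squares R = {x [^]\<^bsub>R\<^esub> (2::nat) |x. x \<in> carrier R}"

definition diop3 :: "int \<Rightarrow> ('a, 'b) ring_scheme \<Rightarrow> 'a measure \<Rightarrow> real" where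
  "diop3 r R M =
     measure (M \<Otimes>\<^sub>M (M \<Otimes>\<^sub>M M))
       {(a, b, c). a \<in> carrier R \<and> b \<in> carrier R \<and> c \<in> carrier R \<and>
          (a \<otimes>\<^bsub>R\<^esub> b) \<oplus>\<^bsub>R\<^esub> ([r] \<cdot>\<^bsub>R\<^esub> \<one>\<^bsub>R\<^esub>) \<in> squares R \<and>
          (b \<otimes>\<^bsub>R\<^esub> c) \<oplus>\<^bsub>R\<^esub> ([r] \<cdot>\<^bsub>R\<^esub> \<one>\<^bsub>R\<^esub>) \<in> squares R \<and>
          (a \<otimes>\<^bsub>R\<^esub> c) \<oplus>\<^bsub>R\<^esub> ([r] \<cdot>\<^bsub>R\<^esub> \<one>\<^bsub>R\<^esub>) \<in> squares R}"

end

theory Submission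
  imports "HOL-Decision_Procs.Algebra_Aux" "HOL-Probability.Probability_Measure" Defs
begin

text \<open>
  Let \<open>k\<close> be the residue field, with \<open>q\<close> elements. A unit of the valuation ring is a square iff its
  residue is one (Hensel), so up to the triples where one of \<open>ab + r\<close>, \<open>bc + r\<close>, \<open>ac + r\<close> vanishes in
  \<open>k\<close>, a set of measure at most \<open>3 / q\<close>, the measure is \<open>N / q\<^sup>3\<close>, where \<open>N\<close> counts the triples over
  \<open>k\<close> for which all three are nonzero squares. With the quadratic character \<open>\<chi>\<close> of \<open>k\<close>, \<open>8 N\<close> is the sum of
  \<open>(1 + \<chi>(ab + r)) (1 + \<chi>(bc + r)) (1 + \<chi>(ac + r))\<close> up to \<open>O(q\<^sup>2)\<close>. Every nontrivial term contains a sum over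
  one variable \<open>c\<close> of \<open>\<chi>(ac + r) \<chi>(bc + r)\<close> (up to renaming, possibly with \<open>b = 0\<close>), which is bounded by
  1 unless \<open>a = b\<close>.

  Hensel's lemma, the finiteness of \<open>k\<close> and the measurability of the set of triples all rest on the
  fact that the valuation ring is generated modulo \<open>p\<close> by finitely many elements over the integers.
\<close>

section \<open>The p-adic absolute value on the rationals\<close>

text \<open>A \<open>padic_field\<close> supplies only a finite-dimensional extension with an
  ultrametric absolute value, so completeness, finite nets and a finite residue field all have to be
  derived. They come from one observation: integral elements that are independent over the integers
  modulo p are linearly independent over \<open>Qp p\<close>, since a relation can be scaled to have
  largest coefficient 1 and then reduced modulo p. The degree therefore bounds their number, and a
  maximal list generates. Repeated division by p expands integral elements with integer digits, and
  limits are taken coordinatewise: a Cauchy sequence of integers already represents an element of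
  \<open>Qp p\<close>. Working modulo p instead of modulo a uniformizer makes ramification harmless.

  Measurability is a genuine obstacle: triples carry the product sigma-algebra and
  \<open>measure\<close> is 0 outside it, so open sets of triples have to be exhibited as countable
  unions of boxes.\<close>

lemma power_int_le_cancel_iff:
  fixes a :: real
  assumes "a > 1"
  shows "a powi i \<le> a powi j \<longleftrightarrow> i \<le> j"
  using power_int_increasing[of i j a] power_int_strict_increasing[of j i a] assms
  by (meson less_imp_le linorder_not_le)

lemma padic_abs_0 [simp]: "padic_abs p 0 = 0"
  by (simp add: padic_abs_def)

text \<open>Cancelling a common factor shifts both multiplicities equally, so the value can be read
  off any fraction, not only the reduced one that \<open>quotient_of\<close> returns.\<close>

lemma padic_abs_Fract:
  assumes p: "prime p" and "a \<noteq> 0" "b \<noteq> 0"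
  shows "padic_abs p (of_int a / of_int b) =
    real p powi (int (multiplicity (int p) b) - int (multiplicity (int p) a))"
proof -
  obtain c d where q: "quotient_of (of_int a / of_int b) = (c, d)"
    by (metis surj_pair)
  have d: "d > 0" using quotient_of_denom_pos[OF q] .
  have e: "rat_of_int a / of_int b = of_int c / of_int d"
    using quotient_of_div[OF q] .
  hence "rat_of_int (a * d) = of_int (c * b)"
    using assms d by (simp add: field_simps)
  hence eq: "a * d = c * b" by (simp only: of_int_eq_iff)
  have c: "c \<noteq> 0" using eq assms d by auto
  have pp: "prime_elem (int p)" using p by simp
  have "multiplicity (int p) a + multiplicity (int p) d = multiplicity (int p) c + multiplicity (int p) b"
    using eq prime_elem_multiplicity_mult_distrib[OF pp] assms c d
    by (metis less_irrefl)
  hence "int (multiplicity (int p) d) - int (multiplicity (int p) c) =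
    int (multiplicity (int p) b) - int (multiplicity (int p) a)" by linarith
  thus ?thesis using assms q by (simp add: padic_abs_def)
qed

lemma rat_as_quotient:
  fixes x :: rat
  obtains a b where "b \<noteq> 0" "x = of_int a / of_int b"
  by (metis Fract_of_int_quotient less_numeral_extra(3) quotient_of_div quotient_of_denom_pos surj_pair)

lemma padic_abs_eq_powi:
  assumes "prime p" "x \<noteq> 0"
  obtains k where "padic_abs p x = real p powi k"
  using assms padic_abs_def by (metis (no_types, lifting) case_prod_beta)

lemma padic_abs_pos: "prime p \<Longrightarrow> x \<noteq> 0 \<Longrightarrow> padic_abs p x > 0"
  by (metis padic_abs_eq_powi of_nat_0_less_iff prime_gt_0_nat zero_less_power_int)

lemma padic_abs_nonneg: "prime p \<Longrightarrow> padic_abs p x \<ge> 0"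
  by (metis less_eq_real_def padic_abs_0 padic_abs_pos)

lemma padic_abs_mult:
  assumes p: "prime p"
  shows "padic_abs p (x * y) = padic_abs p x * padic_abs p y"
proof (cases "x = 0 \<or> y = 0")
  case False
  obtain a b where x: "b \<noteq> 0" "x = of_int a / of_int b" by (rule rat_as_quotient)
  obtain c d where y: "d \<noteq> 0" "y = of_int c / of_int d" by (rule rat_as_quotient)
  have nz: "a \<noteq> 0" "c \<noteq> 0" using False x y by auto
  have pp: "prime_elem (int p)" using p by simp
  have xy: "x * y = of_int (a * c) / of_int (b * d)" using x y by simp
  have r: "real p \<noteq> 0" using p by (simp add: prime_gt_0_nat)
  show ?thesis
    unfolding xy using x y nz r p
    by (subst padic_abs_Fract)
       (auto simp: padic_abs_Fract prime_elem_multiplicity_mult_distrib[OF pp] power_int_add[symmetric] algebra_simps)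
qed auto

lemma padic_abs_of_int_dvd:
  assumes p: "prime p" and n: "n \<noteq> 0"
  shows "padic_abs p (of_int n) \<le> real p powi (- int k) \<longleftrightarrow> int p ^ k dvd n"
proof -
  have p1: "real p > 1" using p prime_gt_1_nat by simp
  have "padic_abs p (of_int n) = real p powi (- int (multiplicity (int p) n))"
    using padic_abs_Fract[OF p n, of 1] by simp
  hence "padic_abs p (of_int n) \<le> real p powi (- int k) \<longleftrightarrow> k \<le> multiplicity (int p) n"
    using p1 by (simp add: power_int_le_cancel_iff)
  also have "\<dots> \<longleftrightarrow> int p ^ k dvd n"
    using p n by (intro power_dvd_iff_le_multiplicity[symmetric]) (auto dest: prime_gt_1_nat)
  finally show ?thesis .
qed

lemma padic_abs_of_int_le_1: "prime p \<Longrightarrow> padic_abs p (of_int n) \<le> 1"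
  using padic_abs_of_int_dvd[of p n 0] by (cases "n = 0") auto

lemma padic_abs_of_int_le_iff:
  assumes p: "prime p"
  shows "padic_abs p (of_int n) \<le> (1 / real p) ^ k \<longleftrightarrow> int p ^ k dvd n"
  using padic_abs_of_int_dvd[OF p, of n k] p
  by (cases "n = 0") (auto simp: power_int_minus power_one_over inverse_eq_divide)

lemma padic_abs_minus: "prime p \<Longrightarrow> padic_abs p (- x) = padic_abs p x"
proof -
  assume p: "prime p"
  have "padic_abs p (-1) = 1"
    using padic_abs_Fract[OF p, of "-1" 1] by (simp add: multiplicity_unit_right)
  thus ?thesis using padic_abs_mult[OF p, of "-1" x] by simp
qed

text \<open>In lowest terms, \<open>padic_abs p x \<le> 1\<close> forces p not to divide the
  denominator, and \<open>1 + x\<close> can be written over the same denominator.\<close>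

lemma padic_abs_add_1:
  assumes p: "prime p" and x: "padic_abs p x \<le> 1"
  shows "padic_abs p (1 + x) \<le> 1"
proof (cases "x = 0 \<or> 1 + x = 0")
  case True
  then show ?thesis using padic_abs_of_int_le_1[OF p, of 1] by auto
next
  case False
  have p1: "real p > 1" using p prime_gt_1_nat by simp
  obtain a b where b: "b > 0" and cop: "coprime a b" and xe: "x = of_int a / of_int b"
    using quotient_of_div quotient_of_denom_pos quotient_of_coprime by (metis surj_pair)
  have a: "a \<noteq> 0" using xe False by auto
  have "padic_abs p x = real p powi (int (multiplicity (int p) b) - int (multiplicity (int p) a))"
    unfolding xe using padic_abs_Fract[OF p a] b by auto
  hence le: "multiplicity (int p) b \<le> multiplicity (int p) a"
    using x p1 by (metis diff_gt_0_iff_gt le_eq_less_or_eq linorder_not_le of_nat_less_iff one_less_power_int)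
  have mb: "multiplicity (int p) b = 0"
  proof (rule ccontr)
    assume "multiplicity (int p) b \<noteq> 0"
    hence "int p dvd b" "int p dvd a"
      using le not_dvd_imp_multiplicity_0 by fastforce+
    hence "is_unit (int p)" using cop by (metis coprime_common_divisor)
    thus False using p by auto
  qed
  have e: "1 + x = of_int (a + b) / of_int b" using xe b by (simp add: field_simps)
  have nz: "a + b \<noteq> 0" using False e by auto
  have "padic_abs p (1 + x) = real p powi (int (multiplicity (int p) b) - int (multiplicity (int p) (a+b)))"
    unfolding e using padic_abs_Fract[OF p nz] b by auto
  also have "\<dots> \<le> 1" 
    using mb p1 power_int_le_cancel_iff[OF p1, of _ 0] by simp
  finally show ?thesis .
qed

text \<open>Scaling by the term of larger absolute value reduces the ultrametric inequality to
  \<open>padic_abs_add_1\<close>.\<close>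

lemma padic_abs_add:
  assumes p: "prime p"
  shows "padic_abs p (x + y) \<le> max (padic_abs p x) (padic_abs p y)"
proof -
  have *: "padic_abs p (x + y) \<le> padic_abs p x" if "padic_abs p y \<le> padic_abs p x" for x y
  proof (cases "x = 0")
    case True
    with that padic_abs_pos[OF p, of y] show ?thesis by (cases "y = 0") auto
  next
    case False
    have yx: "y = x * (y / x)" using False by simp
    have "padic_abs p x * padic_abs p (y / x) \<le> padic_abs p x * 1"
      using that yx padic_abs_mult[OF p] by (metis mult.right_neutral)
    hence "padic_abs p (y / x) \<le> 1" using padic_abs_pos[OF p False] by simp
    hence "padic_abs p x * padic_abs p (1 + y / x) \<le> padic_abs p x * 1"
      by (intro mult_left_mono padic_abs_add_1 padic_abs_nonneg p)
    moreover have "x * (1 + y / x) = x + y" using False by (simp add: field_simps)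
    ultimately show ?thesis using padic_abs_mult[OF p, of x "1 + y / x"] by simp
  qed
  show ?thesis using *[of x y] *[of y x] by (simp add: add.commute max_def)
qed

lemma padic_abs_diff:
  "prime p \<Longrightarrow> padic_abs p (x - y) \<le> max (padic_abs p x) (padic_abs p y)"
  using padic_abs_add[of p x "- y"] padic_abs_minus by simp

lemma padic_abs_diff_commute: "prime p \<Longrightarrow> padic_abs p (x - y) = padic_abs p (y - x)"
  using padic_abs_minus[of p "x - y"] by simp

lemma padic_abs_1: "prime p \<Longrightarrow> padic_abs p 1 = 1"
  using padic_abs_Fract[of p 1 1] by simp

lemma padic_abs_inverse: "prime p \<Longrightarrow> padic_abs p (inverse x) = inverse (padic_abs p x)"
  using padic_abs_mult[of p x "inverse x"] padic_abs_1 padic_abs_pos[of p x]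
  by (cases "x = 0") (auto simp: field_simps)

lemma padic_abs_abs_diff_le:
  assumes p: "prime p"
  shows "\<bar>padic_abs p x - padic_abs p y\<bar> \<le> padic_abs p (x - y)"
proof -
  have *: "padic_abs p x \<le> padic_abs p (x - y) + padic_abs p y" for x y
    using padic_abs_add[OF p, of "x - y" y] padic_abs_nonneg[OF p, of y] padic_abs_nonneg[OF p, of "x - y"]
    by simp
  show ?thesis using *[of x y] *[of y x] padic_abs_diff_commute[OF p, of x y] by linarith
qed

text \<open>Nonzero values are integral powers of p, so a strict bound gains a full factor p. This
  sharpens the strict inequalities that limits and Cauchy sequences provide.\<close>

lemma padic_abs_discrete:
  assumes p: "prime p" and "padic_abs p x < real p powi (k + 1)"
  shows "padic_abs p x \<le> real p powi k"
proof (cases "x = 0")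
  case True then show ?thesis by simp
next
  case False
  have p1: "real p > 1" using p prime_gt_1_nat by simp
  obtain j where "padic_abs p x = real p powi j" using padic_abs_eq_powi[OF p False] .
  thus ?thesis using assms power_int_le_cancel_iff[OF p1] by (metis linorder_not_le zle_add1_eq_le)
qed

text \<open>The integers exhaust the p-integral rationals modulo p: a Bezout coefficient
  \<open>t\<close> inverts the denominator \<open>b\<close> modulo p, so \<open>t * a\<close> is the
  approximant.\<close>

lemma padic_abs_int_approx:
  assumes p: "prime p" and x: "padic_abs p x \<le> 1"
  obtains n where "padic_abs p (x - of_int n) \<le> 1 / real p"
proof -
  have p1: "real p > 1" using p prime_gt_1_nat by simp
  obtain a b where b: "b > 0" and cop: "coprime a b" and xe: "x = of_int a / of_int b"
    using quotient_of_div quotient_of_denom_pos quotient_of_coprime by (metis surj_pair)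
  have nb: "\<not> int p dvd b"
  proof
    assume d: "int p dvd b"
    have da: "\<not> int p dvd a" using cop d p by (metis coprime_common_divisor not_prime_unit prime_int_nat_transfer of_nat_0_le_iff nat_int prime_nat_int_transfer)
    hence a: "a \<noteq> 0" by auto
    have "multiplicity (int p) b > 0" using d b p by (simp add: prime_multiplicity_gt_zero_iff)
    moreover have "multiplicity (int p) a = 0" using da by (simp add: not_dvd_imp_multiplicity_0)
    moreover have "padic_abs p x = real p powi (int (multiplicity (int p) b) - int (multiplicity (int p) a))"
      unfolding xe using padic_abs_Fract[OF p a] b by auto
    ultimately show False 
      using x power_int_le_cancel_iff[OF p1, of "int (multiplicity (int p) b)" 0] by auto
  qed
  hence "coprime (int p) b" using p by (simp add: prime_imp_coprime)
  then obtain s t where "s * int p + t * b = 1" using bezout_int[of "int p" b] by (metis coprime_imp_gcd_eq_1)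
  hence st: "a - b * (t * a) = int p * (s * a)" by (auto simp: algebra_simps) (metis distrib_left mult.right_neutral mult.commute mult.left_commute)
  have "x - of_int (t * a) = of_int (a - b * (t * a)) * inverse (of_int b)"
    using xe b by (simp add: field_simps)
  hence "padic_abs p (x - of_int (t * a)) = padic_abs p (of_int (a - b * (t * a))) * inverse (padic_abs p (of_int b))"
    by (simp only: padic_abs_mult[OF p] padic_abs_inverse[OF p])
  also have "padic_abs p (of_int b) = 1"
    using padic_abs_of_int_dvd[OF p, of b 1] padic_abs_Fract[OF p, of b 1] nb b
    by (simp add: not_dvd_imp_multiplicity_0)
  also have "padic_abs p (of_int (a - b * (t * a))) \<le> (1 / real p) ^ 1"
    by (subst padic_abs_of_int_le_iff[OF p]) (simp add: st)
  finally show ?thesis using that[of "t * a"] by simp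
qed

section \<open>The ring of Cauchy sequences and its quotient\<close>

lemma padic_CauchyD:
  assumes "X \<in> padic_Cauchy_seqs p" "e > 0"
  obtains N where "\<And>m n. m \<ge> N \<Longrightarrow> n \<ge> N \<Longrightarrow> padic_abs p (X m - X n) < e"
  using assms unfolding padic_Cauchy_seqs_def by blast

lemma padic_Cauchy_seqs_const: "(\<lambda>_. x) \<in> padic_Cauchy_seqs p"
  by (simp add: padic_Cauchy_seqs_def)

lemma padic_Cauchy_seqs_add:
  assumes p: "prime p" and "X \<in> padic_Cauchy_seqs p" "Y \<in> padic_Cauchy_seqs p"
  shows "(\<lambda>n. X n + Y n) \<in> padic_Cauchy_seqs p"
  unfolding padic_Cauchy_seqs_def
proof (intro CollectI allI impI)
  fix e :: real assume e: "e > 0"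
  obtain N where N: "\<And>m n. m \<ge> N \<Longrightarrow> n \<ge> N \<Longrightarrow> padic_abs p (X m - X n) < e"
    by (rule padic_CauchyD[OF assms(2) e]) blast
  obtain M where M: "\<And>m n. m \<ge> M \<Longrightarrow> n \<ge> M \<Longrightarrow> padic_abs p (Y m - Y n) < e"
    by (rule padic_CauchyD[OF assms(3) e]) blast
  have "padic_abs p (X m + Y m - (X n + Y n)) < e" if "m \<ge> max M N" "n \<ge> max M N" for m n
  proof -
    have "X m + Y m - (X n + Y n) = (X m - X n) + (Y m - Y n)" by simp
    hence "padic_abs p (X m + Y m - (X n + Y n)) \<le> max (padic_abs p (X m - X n)) (padic_abs p (Y m - Y n))"
      using padic_abs_add[OF p, of "X m - X n" "Y m - Y n"] by (simp only:)
    thus ?thesis using N[of m n] M[of m n] that by auto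
  qed
  thus "\<exists>N. \<forall>m\<ge>N. \<forall>n\<ge>N. padic_abs p (X m + Y m - (X n + Y n)) < e" by blast
qed

text \<open>By the reverse triangle inequality the absolute values form a real Cauchy sequence;
  their limit is the value that \<open>Qp_abs\<close> assigns to the class.\<close>

lemma padic_abs_Cauchy_convergent:
  assumes p: "prime p" and "X \<in> padic_Cauchy_seqs p"
  shows "convergent (\<lambda>n. padic_abs p (X n))"
proof -
  have "Cauchy (\<lambda>n. padic_abs p (X n))"
  proof (rule CauchyI)
    fix e :: real assume e: "e > 0"
    obtain N where N: "\<And>m n. m \<ge> N \<Longrightarrow> n \<ge> N \<Longrightarrow> padic_abs p (X m - X n) < e"
      by (rule padic_CauchyD[OF assms(2) e]) blast
    show "\<exists>M. \<forall>m\<ge>M. \<forall>n\<ge>M. norm (padic_abs p (X m) - padic_abs p (X n)) < e"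
      using N padic_abs_abs_diff_le[OF p] by (metis real_norm_def order_le_less_trans)
  qed
  thus ?thesis by (rule Cauchy_convergent)
qed

lemma padic_Cauchy_bounded:
  assumes "prime p" "X \<in> padic_Cauchy_seqs p"
  obtains B where "B > 0" "\<And>n. padic_abs p (X n) \<le> B"
  using convergent_imp_Bseq[OF padic_abs_Cauchy_convergent[OF assms]] padic_abs_nonneg[OF assms(1)]
  by (auto elim!: BseqE)

lemma padic_Cauchy_seqs_mult:
  assumes p: "prime p" and "X \<in> padic_Cauchy_seqs p" "Y \<in> padic_Cauchy_seqs p"
  shows "(\<lambda>n. X n * Y n) \<in> padic_Cauchy_seqs p"
  unfolding padic_Cauchy_seqs_def
proof (intro CollectI allI impI)
  fix e :: real assume e: "e > 0"
  obtain A where A: "A > 0" "\<And>n. padic_abs p (X n) \<le> A" by (rule padic_Cauchy_bounded[OF p assms(2)]) blast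
  obtain B where B: "B > 0" "\<And>n. padic_abs p (Y n) \<le> B" by (rule padic_Cauchy_bounded[OF p assms(3)]) blast
  obtain N where N: "\<And>m n. m \<ge> N \<Longrightarrow> n \<ge> N \<Longrightarrow> padic_abs p (X m - X n) < e / B"
    by (rule padic_CauchyD[OF assms(2), of "e / B"]) (use e B in auto)
  obtain M where M: "\<And>m n. m \<ge> M \<Longrightarrow> n \<ge> M \<Longrightarrow> padic_abs p (Y m - Y n) < e / A"
    by (rule padic_CauchyD[OF assms(3), of "e / A"]) (use e A in auto)
  have "padic_abs p (X m * Y m - X n * Y n) < e" if "m \<ge> max M N" "n \<ge> max M N" for m n
  proof -
    have "X m * Y m - X n * Y n = (X m - X n) * Y m + X n * (Y m - Y n)" by (simp add: algebra_simps)
    hence "padic_abs p (X m * Y m - X n * Y n) \<le>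
      max (padic_abs p (X m - X n) * padic_abs p (Y m)) (padic_abs p (X n) * padic_abs p (Y m - Y n))"
      using padic_abs_add[OF p] padic_abs_mult[OF p] by metis
    moreover have "padic_abs p (X m - X n) * padic_abs p (Y m) \<le> padic_abs p (X m - X n) * B"
      by (intro mult_left_mono B padic_abs_nonneg p)
    moreover have "padic_abs p (X n) * padic_abs p (Y m - Y n) \<le> A * padic_abs p (Y m - Y n)"
      by (intro mult_right_mono A padic_abs_nonneg p)
    moreover have "padic_abs p (X m - X n) * B < e" "A * padic_abs p (Y m - Y n) < e"
      using N[of m n] M[of m n] that A B by (simp_all add: field_simps)
    ultimately show ?thesis by linarith
  qed
  thus "\<exists>N. \<forall>m\<ge>N. \<forall>n\<ge>N. padic_abs p (X m * Y m - X n * Y n) < e" by blast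
qed

lemma padic_Cauchy_seqs_minus:
  assumes p: "prime p" and "X \<in> padic_Cauchy_seqs p"
  shows "(\<lambda>n. - X n) \<in> padic_Cauchy_seqs p"
  using padic_Cauchy_seqs_mult[OF p padic_Cauchy_seqs_const[of "-1"] assms(2)] by simp

lemma cring_padic_Cauchy_ring:
  assumes p: "prime p"
  shows "cring (padic_Cauchy_ring p)"
proof (rule cringI)
  show "abelian_group (padic_Cauchy_ring p)"
  proof (rule abelian_groupI)
    fix X assume "X \<in> carrier (padic_Cauchy_ring p)"
    thus "\<exists>Y\<in>carrier (padic_Cauchy_ring p). Y \<oplus>\<^bsub>padic_Cauchy_ring p\<^esub> X = \<zero>\<^bsub>padic_Cauchy_ring p\<^esub>"
      using padic_Cauchy_seqs_minus[OF p, of X]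
      by (intro bexI[of _ "\<lambda>n. - X n"]) (auto simp: padic_Cauchy_ring_def)
  qed (auto simp: padic_Cauchy_ring_def padic_Cauchy_seqs_const padic_Cauchy_seqs_add[OF p] algebra_simps)
  show "Group.comm_monoid (padic_Cauchy_ring p)"
    by (rule comm_monoidI)
       (auto simp: padic_Cauchy_ring_def padic_Cauchy_seqs_const padic_Cauchy_seqs_mult[OF p] algebra_simps)
qed (auto simp: padic_Cauchy_ring_def algebra_simps)

lemma padic_null_seqs_subset_Cauchy:
  assumes p: "prime p"
  shows "padic_null_seqs p \<subseteq> padic_Cauchy_seqs p"
proof
  fix X assume "X \<in> padic_null_seqs p"
  hence X: "(\<lambda>n. padic_abs p (X n)) \<longlonglongrightarrow> 0" by (simp add: padic_null_seqs_def)
  show "X \<in> padic_Cauchy_seqs p"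
    unfolding padic_Cauchy_seqs_def
  proof (intro CollectI allI impI)
    fix e :: real assume "e > 0"
    from LIMSEQ_D[OF X this] obtain N where N: "\<And>n. n \<ge> N \<Longrightarrow> padic_abs p (X n) < e"
      using padic_abs_nonneg[OF p] by auto
    thus "\<exists>N. \<forall>m\<ge>N. \<forall>n\<ge>N. padic_abs p (X m - X n) < e"
      using padic_abs_diff[OF p] by (intro exI[of _ N]) (meson max_less_iff_conj order_le_less_trans)
  qed
qed

lemma padic_null_seqs_add:
  assumes p: "prime p" and "X \<in> padic_null_seqs p" "Y \<in> padic_null_seqs p"
  shows "(\<lambda>n. X n + Y n) \<in> padic_null_seqs p"
proof -
  have "(\<lambda>n. max (padic_abs p (X n)) (padic_abs p (Y n))) \<longlonglongrightarrow> max 0 0"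
    using assms by (intro tendsto_max) (auto simp: padic_null_seqs_def)
  thus ?thesis unfolding padic_null_seqs_def
    by (intro CollectI tendsto_sandwich[of "\<lambda>_. 0" "\<lambda>n. padic_abs p (X n + Y n)"])
       (auto simp: padic_abs_nonneg[OF p] padic_abs_add[OF p])
qed

lemma padic_null_seqs_mult:
  assumes p: "prime p" and "X \<in> padic_Cauchy_seqs p" "Y \<in> padic_null_seqs p"
  shows "(\<lambda>n. X n * Y n) \<in> padic_null_seqs p"
proof -
  obtain l where "(\<lambda>n. padic_abs p (X n)) \<longlonglongrightarrow> l"
    using padic_abs_Cauchy_convergent[OF assms(1,2)] convergent_def by blast
  from tendsto_mult[OF this, of "\<lambda>n. padic_abs p (Y n)" 0] assms(3)
  show ?thesis by (simp add: padic_null_seqs_def padic_abs_mult[OF p])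
qed

lemma ideal_padic_null_seqs:
  assumes p: "prime p"
  shows "ideal (padic_null_seqs p) (padic_Cauchy_ring p)"
proof -
  interpret cring "padic_Cauchy_ring p" by (rule cring_padic_Cauchy_ring[OF p])
  show ?thesis
  proof (rule idealI[OF ring_axioms])
    show "subgroup (padic_null_seqs p) (add_monoid (padic_Cauchy_ring p))"
    proof (rule group.subgroupI[OF add.is_group])
      show "padic_null_seqs p \<subseteq> carrier (add_monoid (padic_Cauchy_ring p))"
        using padic_null_seqs_subset_Cauchy[OF p] by (simp add: padic_Cauchy_ring_def)
      have "(\<lambda>_. 0) \<in> padic_null_seqs p" by (simp add: padic_null_seqs_def)
      thus "padic_null_seqs p \<noteq> {}" by blast
      fix X assume X: "X \<in> padic_null_seqs p"
      have N: "(\<lambda>n. - X n) \<in> padic_null_seqs p"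
        using X by (simp add: padic_null_seqs_def padic_abs_minus[OF p])
      have "inv\<^bsub>add_monoid (padic_Cauchy_ring p)\<^esub> X = (\<lambda>n. - X n)"
        using X N padic_null_seqs_subset_Cauchy[OF p]
        by (intro group.inv_equality[OF add.is_group]) (auto simp: padic_Cauchy_ring_def)
      thus "inv\<^bsub>add_monoid (padic_Cauchy_ring p)\<^esub> X \<in> padic_null_seqs p" using N by simp
      fix Y assume Y: "Y \<in> padic_null_seqs p"
      show "X \<otimes>\<^bsub>add_monoid (padic_Cauchy_ring p)\<^esub> Y \<in> padic_null_seqs p"
        using padic_null_seqs_add[OF p X Y] by (simp add: padic_Cauchy_ring_def)
    qed
  next
    fix a x assume "a \<in> padic_null_seqs p" "x \<in> carrier (padic_Cauchy_ring p)"
    hence "(\<lambda>n. x n * a n) \<in> padic_null_seqs p"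
      by (intro padic_null_seqs_mult[OF p]) (auto simp: padic_Cauchy_ring_def)
    thus "x \<otimes>\<^bsub>padic_Cauchy_ring p\<^esub> a \<in> padic_null_seqs p" "a \<otimes>\<^bsub>padic_Cauchy_ring p\<^esub> x \<in> padic_null_seqs p"
      by (simp_all add: padic_Cauchy_ring_def mult.commute)
  qed
qed

definition padic_class :: "nat \<Rightarrow> (nat \<Rightarrow> rat) \<Rightarrow> (nat \<Rightarrow> rat) set" where
  "padic_class p X = padic_null_seqs p +>\<^bsub>padic_Cauchy_ring p\<^esub> X"

lemma padic_class_hom:
  assumes p: "prime p"
  shows "padic_class p \<in> ring_hom (padic_Cauchy_ring p) (Qp p)"
  using ideal.rcos_ring_hom[OF ideal_padic_null_seqs[OF p]]
  by (simp add: Qp_def padic_class_def[abs_def])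

lemma carrier_Qp: "carrier (Qp p) = padic_class p ` padic_Cauchy_seqs p"
  by (auto simp: Qp_def FactRing_def A_RCOSETS_def' padic_class_def padic_Cauchy_ring_def)

text \<open>Members of one coset differ by a null sequence, so their absolute values share a limit;
  since \<open>X\<close> lies in its own coset, that limit is the only candidate for the
  \<open>THE\<close> in \<open>Qp_abs\<close>.\<close>

lemma Qp_abs_class:
  assumes p: "prime p" and X: "X \<in> padic_Cauchy_seqs p"
    and l: "(\<lambda>n. padic_abs p (X n)) \<longlonglongrightarrow> l"
  shows "Qp_abs p (padic_class p X) = l"
  unfolding Qp_abs_def
proof (rule the_equality)
  have *: "padic_class p X = {\<lambda>n. Z n + X n |Z. Z \<in> padic_null_seqs p}"
    by (auto simp: padic_class_def a_r_coset_def' padic_Cauchy_ring_def)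
  show "\<forall>Y\<in>padic_class p X. (\<lambda>n. padic_abs p (Y n)) \<longlonglongrightarrow> l"
  proof
    fix Y assume "Y \<in> padic_class p X"
    then obtain Z where Z: "Z \<in> padic_null_seqs p" "Y = (\<lambda>n. Z n + X n)" using * by blast
    have "(\<lambda>n. padic_abs p (Y n) - padic_abs p (X n)) \<longlonglongrightarrow> 0"
    proof (rule Lim_null_comparison)
      show "\<forall>\<^sub>F n in sequentially. norm (padic_abs p (Y n) - padic_abs p (X n)) \<le> padic_abs p (Z n)"
      proof (intro always_eventually allI)
        fix n show "norm (padic_abs p (Y n) - padic_abs p (X n)) \<le> padic_abs p (Z n)"
          using padic_abs_abs_diff_le[OF p, of "Y n" "X n"] Z by simp
      qed
      show "(\<lambda>n. padic_abs p (Z n)) \<longlonglongrightarrow> 0" using Z by (simp add: padic_null_seqs_def)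
    qed
    from tendsto_add[OF this l] show "(\<lambda>n. padic_abs p (Y n)) \<longlonglongrightarrow> l" by simp
  qed
  fix l' assume "\<forall>Y\<in>padic_class p X. (\<lambda>n. padic_abs p (Y n)) \<longlonglongrightarrow> l'"
  moreover have "X \<in> padic_class p X"
    unfolding * by (intro CollectI exI[of _ "\<lambda>_. 0"]) (simp add: padic_null_seqs_def)
  ultimately show "l' = l" using l LIMSEQ_unique by blast
qed

text \<open>For a sequence that is not null the absolute values have a positive limit, so the terms
  are eventually bounded away from 0 and termwise inversion is Cauchy. Zero terms, finitely many,
  are inverted to 0 and disappear modulo null sequences.\<close>

lemma padic_Cauchy_inverse:
  assumes p: "prime p" and X: "X \<in> padic_Cauchy_seqs p" and nz: "X \<notin> padic_null_seqs p"
  shows "(\<lambda>n. inverse (X n)) \<in> padic_Cauchy_seqs p"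
    "(\<lambda>n. 1 - X n * inverse (X n)) \<in> padic_null_seqs p"
proof -
  obtain l where l: "(\<lambda>n. padic_abs p (X n)) \<longlonglongrightarrow> l"
    using padic_abs_Cauchy_convergent[OF p X] convergent_def by blast
  have "l \<noteq> 0" using l nz by (auto simp: padic_null_seqs_def)
  moreover have "l \<ge> 0" by (rule LIMSEQ_le_const[OF l]) (auto simp: padic_abs_nonneg[OF p])
  ultimately have l0: "l > 0" by simp
  have "\<forall>\<^sub>F n in sequentially. padic_abs p (X n) > l / 2"
    using l l0 by (intro order_tendstoD) auto
  then obtain N0 where N0: "\<And>n. n \<ge> N0 \<Longrightarrow> padic_abs p (X n) > l / 2"
    by (auto simp: eventually_sequentially)
  have nz': "X n \<noteq> 0" if "n \<ge> N0" for n using N0[OF that] l0 by auto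
  show "(\<lambda>n. 1 - X n * inverse (X n)) \<in> padic_null_seqs p"
    unfolding padic_null_seqs_def
    by (intro CollectI tendsto_eventually) (auto simp: eventually_sequentially nz' intro!: exI[of _ N0])
  show "(\<lambda>n. inverse (X n)) \<in> padic_Cauchy_seqs p"
    unfolding padic_Cauchy_seqs_def
  proof (intro CollectI allI impI)
    fix e :: real assume e: "e > 0"
    obtain N where N: "\<And>m n. m \<ge> N \<Longrightarrow> n \<ge> N \<Longrightarrow> padic_abs p (X m - X n) < e * (l / 2 * (l / 2))"
      by (rule padic_CauchyD[OF X, of "e * (l / 2 * (l / 2))"]) (use e l0 in auto)
    have "padic_abs p (inverse (X m) - inverse (X n)) < e" if "m \<ge> max N N0" "n \<ge> max N N0" for m n
    proof -
      have "X n - X m = (inverse (X m) - inverse (X n)) * (X m * X n)"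
        using nz'[of m] nz'[of n] that by (simp add: field_simps)
      hence "padic_abs p (X m - X n) =
          padic_abs p (inverse (X m) - inverse (X n)) * (padic_abs p (X m) * padic_abs p (X n))"
        by (metis padic_abs_mult[OF p] padic_abs_diff_commute[OF p])
      moreover have "padic_abs p (inverse (X m) - inverse (X n)) * (l / 2 * (l / 2)) \<le>
        padic_abs p (inverse (X m) - inverse (X n)) * (padic_abs p (X m) * padic_abs p (X n))"
        using N0[of m] N0[of n] that l0
        by (intro mult_left_mono mult_mono padic_abs_nonneg p) auto
      ultimately have "padic_abs p (inverse (X m) - inverse (X n)) * (l / 2 * (l / 2)) < e * (l / 2 * (l / 2))"
        using N[of m n] that by simp
      thus ?thesis using l0 by (simp add: mult_less_cancel_right)
    qed
    thus "\<exists>N. \<forall>m\<ge>N. \<forall>n\<ge>N. padic_abs p (inverse (X m) - inverse (X n)) < e" by blast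
  qed
qed

section \<open>The image of the p-adic numbers in a finite extension\<close>

context padic_field
begin

section \<open>The ultrametric absolute value on the extension\<close>

lemma v_zero [simp]: "v \<zero> = 0"
  by (simp add: v_eq_0_iff)

lemma v_one [simp]: "v \<one> = 1"
proof -
  have "v \<one> = v \<one> * v \<one>" using v_mult[of \<one> \<one>] by simp
  moreover have "v \<one> \<noteq> 0" by (simp add: v_eq_0_iff)
  ultimately show ?thesis by simp
qed

lemma v_minus [simp]: "x \<in> carrier K \<Longrightarrow> v (\<ominus> x) = v x"
proof -
  assume x: "x \<in> carrier K"
  have "v (\<ominus> x) * v (\<ominus> x) = v x * v x"
    using x v_mult[of "\<ominus> x" "\<ominus> x"] v_mult[of x x] by (simp add: l_minus r_minus)
  thus ?thesis using x v_nonneg[of x] v_nonneg[of "\<ominus> x"]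
    by (metis a_inv_closed abs_of_nonneg real_sqrt_abs2)
qed

lemma v_diff: "x \<in> carrier K \<Longrightarrow> y \<in> carrier K \<Longrightarrow> v (x \<ominus> y) \<le> max (v x) (v y)"
  using v_add[of x "\<ominus> y"] by (simp add: minus_eq)

lemma v_diff_commute: "x \<in> carrier K \<Longrightarrow> y \<in> carrier K \<Longrightarrow> v (x \<ominus> y) = v (y \<ominus> x)"
proof -
  assume xy: "x \<in> carrier K" "y \<in> carrier K"
  hence "\<ominus> (x \<ominus> y) = y \<ominus> x" by (intro minus_equality) (auto, algebra)
  thus ?thesis using v_minus[of "x \<ominus> y"] xy by simp
qed

lemma v_diff_trans:
  assumes "x \<in> carrier K" "y \<in> carrier K" "z \<in> carrier K" "v (x \<ominus> y) \<le> c" "v (y \<ominus> z) \<le> c"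
  shows "v (x \<ominus> z) \<le> c"
proof -
  have "x \<ominus> z = (x \<ominus> y) \<oplus> (y \<ominus> z)" using assms(1-3) by algebra
  thus ?thesis using v_add[of "x \<ominus> y" "y \<ominus> z"] assms by simp
qed

lemma v_mult_le:
  assumes "x \<in> carrier K" "y \<in> carrier K" "v x \<le> a" "v y \<le> b"
  shows "v (x \<otimes> y) \<le> a * b"
  using assms v_nonneg[of x] v_nonneg[of y] by (simp add: v_mult mult_mono)

lemma v_inv:
  assumes "x \<in> carrier K" "x \<noteq> \<zero>"
  shows "v (inv x) = inverse (v x)"
  using v_mult[of x "inv x"] assms v_eq_0_iff[of x] by (simp add: field_simps)

text \<open>Composing the quotient map with \<open>\<phi>\<close> lets elements of the image of
  \<open>Qp p\<close> be handled through rational sequences instead of cosets.\<close>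

definition padic_embed :: "(nat \<Rightarrow> rat) \<Rightarrow> 'a" where
  "padic_embed X = \<phi> (padic_class p X)"

lemma padic_embed_hom: "padic_embed \<in> ring_hom (padic_Cauchy_ring p) K"
  using ring_hom_trans[OF padic_class_hom[OF prime_p] embedding]
  by (simp add: padic_embed_def[abs_def] comp_def)

lemma padic_embed_closed [simp]: "X \<in> padic_Cauchy_seqs p \<Longrightarrow> padic_embed X \<in> carrier K"
  using ring_hom_closed[OF padic_embed_hom] by (simp add: padic_Cauchy_ring_def)

lemma padic_embed_add:
  "X \<in> padic_Cauchy_seqs p \<Longrightarrow> Y \<in> padic_Cauchy_seqs p \<Longrightarrow>
    padic_embed (\<lambda>n. X n + Y n) = padic_embed X \<oplus> padic_embed Y"
  using ring_hom_add[OF padic_embed_hom] by (simp add: padic_Cauchy_ring_def)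

lemma padic_embed_mult:
  "X \<in> padic_Cauchy_seqs p \<Longrightarrow> Y \<in> padic_Cauchy_seqs p \<Longrightarrow>
    padic_embed (\<lambda>n. X n * Y n) = padic_embed X \<otimes> padic_embed Y"
  using ring_hom_mult[OF padic_embed_hom] by (simp add: padic_Cauchy_ring_def)

lemma padic_embed_1: "padic_embed (\<lambda>_. 1) = \<one>"
  using ring_hom_one[OF padic_embed_hom] by (simp add: padic_Cauchy_ring_def)

lemma padic_embed_of_int: "padic_embed (\<lambda>_. of_int n) = \<guillemotleft>n\<guillemotright>"
proof (induction n rule: int_induct[where k = 0])
  case base
  have "padic_embed (\<lambda>_. 0) = padic_embed (\<lambda>_. 0) \<oplus> padic_embed (\<lambda>_. 0)"
    using padic_embed_add[of "\<lambda>_. 0" "\<lambda>_. 0"] padic_Cauchy_seqs_const by simp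
  thus ?case using padic_Cauchy_seqs_const by simp
next
  case (step1 i)
  thus ?case
    using padic_embed_add[of "\<lambda>_. of_int i" "\<lambda>_. 1"] padic_Cauchy_seqs_const padic_embed_1 by simp
next
  case (step2 i)
  have "padic_embed (\<lambda>_. of_int (i - 1)) \<oplus> \<one> = \<guillemotleft>i\<guillemotright>"
    using step2 padic_embed_add[of "\<lambda>_. of_int (i - 1)" "\<lambda>_. 1"] padic_Cauchy_seqs_const padic_embed_1
    by simp
  moreover have "\<guillemotleft>i\<guillemotright> = \<guillemotleft>i - 1\<guillemotright> \<oplus> \<one>" using of_int_add[of "i - 1" 1] by simp
  ultimately show ?case using padic_Cauchy_seqs_const
    by (metis add.right_cancel of_int_closed one_closed padic_embed_closed)
qed

lemma v_padic_embed:
  assumes "X \<in> padic_Cauchy_seqs p" "(\<lambda>n. padic_abs p (X n)) \<longlonglongrightarrow> l"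
  shows "v (padic_embed X) = l"
  unfolding padic_embed_def using v_extends carrier_Qp Qp_abs_class[OF prime_p assms] assms(1)
  by auto

lemma v_of_int: "v \<guillemotleft>n\<guillemotright> = padic_abs p (of_int n)"
  using v_padic_embed[of "\<lambda>_. of_int n"] padic_Cauchy_seqs_const padic_embed_of_int by simp

lemma v_of_int_le_1: "v \<guillemotleft>n\<guillemotright> \<le> 1"
  by (simp add: v_of_int padic_abs_of_int_le_1[OF prime_p])

lemma v_of_int_le_iff: "v \<guillemotleft>n\<guillemotright> \<le> (1 / real p) ^ k \<longleftrightarrow> int p ^ k dvd n"
  by (simp add: v_of_int padic_abs_of_int_le_iff[OF prime_p])

lemma v_of_int_coprime: "\<not> int p dvd n \<Longrightarrow> v \<guillemotleft>n\<guillemotright> = 1"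
  using padic_abs_Fract[OF prime_p, of n 1]
  by (cases "n = 0") (auto simp: v_of_int not_dvd_imp_multiplicity_0)

lemma v_of_int_prime_power: "v \<guillemotleft>int p ^ k\<guillemotright> = (1 / real p) ^ k"
proof -
  have "multiplicity (int p) (int p ^ k) = k"
    using prime_p by (intro multiplicity_same_power) (auto dest: prime_gt_1_nat)
  thus ?thesis
    using padic_abs_Fract[OF prime_p, of "int p ^ k" 1] prime_gt_0_nat[OF prime_p]
    unfolding v_of_int by (simp add: power_int_minus power_one_over inverse_eq_divide)
qed

text \<open>The left side is a limit of rational absolute values, so a bound that holds from
  \<open>N\<close> on passes to it.\<close>

lemma padic_embed_diff_le:
  assumes X: "X \<in> padic_Cauchy_seqs p" and le: "\<And>m. m \<ge> N \<Longrightarrow> padic_abs p (X m - of_int n) \<le> c"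
  shows "v (padic_embed X \<ominus> \<guillemotleft>n\<guillemotright>) \<le> c"
proof -
  have Y: "(\<lambda>m. X m + of_int (- n)) \<in> padic_Cauchy_seqs p"
    by (intro padic_Cauchy_seqs_add X padic_Cauchy_seqs_const prime_p)
  have eq: "padic_embed X \<ominus> \<guillemotleft>n\<guillemotright> = padic_embed (\<lambda>m. X m + of_int (- n))"
    using X padic_embed_add[of X "\<lambda>_. of_int (- n)"] padic_embed_of_int[of "- n"] padic_Cauchy_seqs_const
    by (simp add: minus_eq)
  obtain l where l: "(\<lambda>m. padic_abs p (X m + of_int (- n))) \<longlonglongrightarrow> l"
    using padic_abs_Cauchy_convergent[OF prime_p Y] convergent_def by blast
  have "l \<le> c" by (rule LIMSEQ_le_const2[OF l]) (use le in auto)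
  thus ?thesis using v_padic_embed[OF Y l] eq by simp
qed

text \<open>A limit of at most 1 only makes late terms smaller than p in absolute value;
  discreteness sharpens this to at most 1, and differences below 1 to at most 1 / p. An integer
  approximating one late term then serves for the whole tail.\<close>

lemma padic_embed_int_approx:
  assumes X: "X \<in> padic_Cauchy_seqs p" and le: "v (padic_embed X) \<le> 1"
  obtains n where "v (padic_embed X \<ominus> \<guillemotleft>n\<guillemotright>) \<le> 1 / real p"
proof -
  have p1: "real p > 1" using prime_gt_1_nat[OF prime_p] by simp
  obtain l where l: "(\<lambda>m. padic_abs p (X m)) \<longlonglongrightarrow> l"
    using padic_abs_Cauchy_convergent[OF prime_p X] convergent_def by blast
  have "l < real p" using le v_padic_embed[OF X l] p1 by simp
  hence "\<forall>\<^sub>F m in sequentially. padic_abs p (X m) < real p" using l by (intro order_tendstoD)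
  then obtain M where M: "\<And>m. m \<ge> M \<Longrightarrow> padic_abs p (X m) < real p"
    by (auto simp: eventually_sequentially)
  obtain N where N: "\<And>m n. m \<ge> N \<Longrightarrow> n \<ge> N \<Longrightarrow> padic_abs p (X m - X n) < 1"
    by (rule padic_CauchyD[OF X, of 1]) auto
  have N': "padic_abs p (X m - X n) \<le> 1 / real p" if "m \<ge> N" "n \<ge> N" for m n
    using padic_abs_discrete[OF prime_p, of "X m - X n" "-1"] N[OF that]
    by (simp add: power_int_minus inverse_eq_divide)
  define k where "k = max M N"
  have "padic_abs p (X k) \<le> 1" using padic_abs_discrete[OF prime_p, of "X k" 0] M[of k] by (simp add: k_def)
  then obtain n where n: "padic_abs p (X k - of_int n) \<le> 1 / real p"
    using padic_abs_int_approx[OF prime_p] by blast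
  have "padic_abs p (X m - of_int n) \<le> 1 / real p" if "m \<ge> k" for m
  proof -
    have "X m - of_int n = (X m - X k) + (X k - of_int n)" by simp
    hence "padic_abs p (X m - of_int n) \<le> max (padic_abs p (X m - X k)) (padic_abs p (X k - of_int n))"
      using padic_abs_add[OF prime_p] by metis
    thus ?thesis using N'[of m k] n that by (auto simp: k_def)
  qed
  from padic_embed_diff_le[OF X this] show ?thesis using that by blast
qed

lemma range_embedding: "\<phi> ` carrier (Qp p) = padic_embed ` padic_Cauchy_seqs p"
  by (auto simp: carrier_Qp padic_embed_def)

text \<open>Zero is detected through \<open>v\<close>: null sequences have image zero, so a nonzero
  image comes from a sequence that is not null, and its termwise inverse represents the
  inverse.\<close>

lemma subfield_Qp: "subfield (\<phi> ` carrier (Qp p)) K"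
proof (rule subfieldI')
  interpret C: cring "padic_Cauchy_ring p" by (rule cring_padic_Cauchy_ring[OF prime_p])
  interpret h: ring_hom_ring "padic_Cauchy_ring p" K padic_embed
    by (intro ring_hom_ringI2 C.ring_axioms ring_axioms padic_embed_hom)
  have "subring (padic_embed ` carrier (padic_Cauchy_ring p)) K"
    by (intro h.img_is_subring C.carrier_is_subring)
  thus "subring (\<phi> ` carrier (Qp p)) K" by (simp add: range_embedding padic_Cauchy_ring_def)
  fix k assume k: "k \<in> \<phi> ` carrier (Qp p) - {\<zero>}"
  then obtain X where X: "X \<in> padic_Cauchy_seqs p" "k = padic_embed X" by (auto simp: range_embedding)
  have "X \<notin> padic_null_seqs p"
    using k X v_padic_embed[OF X(1), of 0] v_eq_0_iff[of k] by (auto simp: padic_null_seqs_def)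
  note I = padic_Cauchy_inverse[OF prime_p X(1) this]
  define Y where "Y = (\<lambda>n. inverse (X n))"
  have Y: "Y \<in> padic_Cauchy_seqs p" using I by (simp add: Y_def)
  have XY: "(\<lambda>n. X n * Y n) \<in> padic_Cauchy_seqs p" by (intro padic_Cauchy_seqs_mult prime_p X Y)
  have Z: "(\<lambda>n. 1 - X n * Y n) \<in> padic_null_seqs p" using I by (simp add: Y_def)
  have Z': "(\<lambda>n. 1 - X n * Y n) \<in> padic_Cauchy_seqs p"
    using Z padic_null_seqs_subset_Cauchy[OF prime_p] by blast
  have "padic_embed (\<lambda>n. 1 - X n * Y n) = \<zero>"
    using v_padic_embed[OF Z', of 0] Z v_eq_0_iff[OF padic_embed_closed[OF Z']]
    by (simp add: padic_null_seqs_def)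
  moreover have "padic_embed (\<lambda>n. (1 - X n * Y n) + X n * Y n) = padic_embed (\<lambda>n. 1 - X n * Y n) \<oplus> padic_embed X \<otimes> padic_embed Y"
    using padic_embed_add[OF Z' XY] padic_embed_mult[OF X(1) Y] by simp
  ultimately have "k \<otimes> padic_embed Y = \<one>" using X Y padic_embed_1 by simp
  hence "inv k = padic_embed Y" using X Y by (intro inverse_unique) auto
  thus "inv k \<in> \<phi> ` carrier (Qp p)" using Y by (auto simp: range_embedding)
qed

end

section \<open>Integral generators and completeness of the valuation ring\<close>

context padic_field
begin

text \<open>With integral vectors \<open>combine\<close> is nonexpansive in the coefficients, so
  these may be replaced by nearby ones, in particular by integers modulo p.\<close>

lemma v_combine_diff:
  assumes "list_all2 (\<lambda>k l. k \<in> carrier K \<and> l \<in> carrier K \<and> v (k \<ominus> l) \<le> c) Ks Ls"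
    and "set Us \<subseteq> carrier K" "\<And>u. u \<in> set Us \<Longrightarrow> v u \<le> 1" and c: "0 \<le> c"
  shows "v (combine Ks Us \<ominus> combine Ls Us) \<le> c"
  using assms
proof (induction Ks Ls arbitrary: Us rule: list_all2_induct)
  case Nil
  then show ?case by simp
next
  case (Cons k Ks l Ls)
  show ?case
  proof (cases Us)
    case Nil
    then show ?thesis using c by simp
  next
    case (Cons u Us')
    have sub: "set Ks \<subseteq> carrier K" "set Ls \<subseteq> carrier K"
      using Cons.hyps(2) by (auto simp: list_all2_conv_all_nth in_set_conv_nth)
    have u: "u \<in> carrier K" "v u \<le> 1" "set Us' \<subseteq> carrier K" using Cons Cons.prems by auto
    have "k \<otimes> u \<oplus> combine Ks Us' \<ominus> (l \<otimes> u \<oplus> combine Ls Us') =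
        (k \<ominus> l) \<otimes> u \<oplus> (combine Ks Us' \<ominus> combine Ls Us')"
      using u Cons.hyps(1) combine_in_carrier[OF sub(1) u(3)] combine_in_carrier[OF sub(2) u(3)] by algebra
    moreover have "v ((k \<ominus> l) \<otimes> u) \<le> c * 1"
      using u Cons.hyps(1) v_nonneg[of u] c mult_mono[of "v (k \<ominus> l)" c "v u" 1]
      by (subst v_mult) auto
    moreover have "v (combine Ks Us' \<ominus> combine Ls Us') \<le> c"
      using Cons.IH[of Us'] Cons Cons.prems by auto
    ultimately show ?thesis
      using v_add[of "(k \<ominus> l) \<otimes> u" "combine Ks Us' \<ominus> combine Ls Us'"] Cons.hyps(1) u
        combine_in_carrier[OF sub(1) u(3)] combine_in_carrier[OF sub(2) u(3)] Cons
      by simp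
  qed
qed

lemma v_combine_le_1:
  assumes "set Ks \<subseteq> carrier K" "\<And>k. k \<in> set Ks \<Longrightarrow> v k \<le> 1"
    and "set Us \<subseteq> carrier K" "\<And>u. u \<in> set Us \<Longrightarrow> v u \<le> 1"
  shows "v (combine Ks Us) \<le> 1"
  using assms
proof (induction Ks Us rule: combine.induct)
  case (1 k Ks u Us)
  have "v (k \<otimes> u) \<le> 1"
    using 1 v_nonneg[of u] by (subst v_mult) (auto intro!: mult_le_one)
  thus ?case using v_add[of "k \<otimes> u" "combine Ks Us"] 1 by simp
qed auto

text \<open>Linear independence over the field with p elements of the images in the valuation ring
  modulo p, written with integer coefficients. The threshold 1 / p means congruence modulo p, not
  modulo the maximal ideal, so ramified extensions are covered as they are.\<close>

definition residually_independent :: "'a list \<Rightarrow> bool" where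
  "residually_independent Us \<longleftrightarrow> set Us \<subseteq> carrier K \<and> (\<forall>u\<in>set Us. v u \<le> 1) \<and>
     (\<forall>ns. length ns = length Us \<longrightarrow> v (combine (map (\<lambda>n. \<guillemotleft>n\<guillemotright>) ns) Us) \<le> 1 / real p \<longrightarrow>
        (\<forall>n\<in>set ns. int p dvd n))"

text \<open>Divide a relation by its largest coefficient \<open>k\<close>: all coefficients become
  integral and one becomes 1. Integer approximations modulo p then form a relation whose
  coefficients must all be divisible by p, including the one that approximates 1.\<close>

lemma residually_independent_imp_independent:
  assumes Us: "residually_independent Us"
  shows "independent (\<phi> ` carrier (Qp p)) Us"
proof (rule ccontr)
  let ?F = "\<phi> ` carrier (Qp p)"
  have F: "?F \<subseteq> carrier K" using subfieldE(3)[OF subfield_Qp] .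
  have p1: "real p > 1" using prime_gt_1_nat[OF prime_p] by simp
  have U: "set Us \<subseteq> carrier K" "\<And>u. u \<in> set Us \<Longrightarrow> v u \<le> 1"
    using Us by (auto simp: residually_independent_def)
  assume "dependent ?F Us"
  then obtain Ks where Ks: "length Ks = length Us" "combine Ks Us = \<zero>" "set Ks \<subseteq> ?F" "\<not> set Ks \<subseteq> {\<zero>}"
  proof (rule dependent_imp_non_trivial_combine[OF subfield_Qp U(1)])
    fix Ks assume "length Ks = length Us" "set Ks \<noteq> {\<zero>}" "combine Ks Us = \<zero>" "set Ks \<subseteq> ?F"
    moreover have "Us \<noteq> []" using \<open>dependent ?F Us\<close> by auto
    ultimately show ?thesis using that[of Ks] by (cases Ks) auto
  qed
  have KsK: "set Ks \<subseteq> carrier K" using Ks F by blast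
  have ne: "Ks \<noteq> []" using Ks by auto
  define M where "M = Max (v ` set Ks)"
  have "M \<in> v ` set Ks" unfolding M_def using ne by (intro Max_in) auto
  then obtain k where k: "k \<in> set Ks" "v k = M" by auto
  have M: "v x \<le> v k" if "x \<in> set Ks" for x using that k by (auto simp: M_def)
  have kK: "k \<in> carrier K" using k KsK by auto
  have k0: "k \<noteq> \<zero>"
  proof
    assume "k = \<zero>"
    hence "v x = 0" if "x \<in> set Ks" for x using M[OF that] v_nonneg[of x] KsK that by auto
    hence "set Ks \<subseteq> {\<zero>}" using v_eq_0_iff KsK by blast
    thus False using Ks by simp
  qed
  define Ls where "Ls = map ((\<otimes>) (inv k)) Ks"
  have ik: "inv k \<in> carrier K" using k0 kK by simp
  have ikF: "inv k \<in> ?F" using subfield_m_inv(1)[OF subfield_Qp] k k0 Ks by blast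
  have 1: "combine Ls Us = \<zero>"
    using combine_r_distr[OF KsK U(1) ik] Ks ik by (simp add: Ls_def)
  have LsF: "set Ls \<subseteq> ?F"
    using subringE(6)[OF subfieldE(1)[OF subfield_Qp]] ikF Ks by (auto simp: Ls_def)
  have LsK: "set Ls \<subseteq> carrier K" using LsF F by blast
  have Lv: "v x \<le> 1" if x: "x \<in> set Ls" for x
  proof -
    obtain y where y: "y \<in> set Ks" "x = inv k \<otimes> y" using x by (auto simp: Ls_def)
    have "v x = inverse (v k) * v y" using y kK k0 KsK ik by (auto simp: v_mult v_inv)
    also have "\<dots> \<le> inverse (v k) * v k" using M[OF y(1)] v_nonneg[OF kK] by (intro mult_left_mono) auto
    also have "\<dots> = 1" using v_eq_0_iff[OF kK] k0 by simp
    finally show ?thesis .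
  qed
  have "\<exists>n. v (x \<ominus> \<guillemotleft>n\<guillemotright>) \<le> 1 / real p" if x: "x \<in> set Ls" for x
  proof -
    obtain X where "X \<in> padic_Cauchy_seqs p" "x = padic_embed X" using LsF x range_embedding by blast
    thus ?thesis using padic_embed_int_approx[of X] Lv[OF x] by metis
  qed
  then obtain f where f: "\<And>x. x \<in> set Ls \<Longrightarrow> v (x \<ominus> \<guillemotleft>f x\<guillemotright>) \<le> 1 / real p" by metis
  have "v (combine Ls Us \<ominus> combine (map (\<lambda>n. \<guillemotleft>n\<guillemotright>) (map f Ls)) Us) \<le> 1 / real p"
    by (rule v_combine_diff)
       (use U LsK f in \<open>auto simp: list_all2_conv_all_nth subset_iff\<close>)
  moreover have cK: "combine (map (\<lambda>n. \<guillemotleft>n\<guillemotright>) (map f Ls)) Us \<in> carrier K"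
    by (intro combine_in_carrier U) auto
  ultimately have "v (combine (map (\<lambda>n. \<guillemotleft>n\<guillemotright>) (map f Ls)) Us) \<le> 1 / real p"
    using 1 by (simp add: minus_eq)
  moreover have "length (map f Ls) = length Us" using Ks by (simp add: Ls_def)
  ultimately have dvd: "\<forall>n\<in>set (map f Ls). int p dvd n"
    using Us unfolding residually_independent_def by blast
  have one: "\<one> \<in> set Ls" unfolding Ls_def using k kK k0 by (auto intro!: image_eqI[of _ _ k])
  hence "int p dvd f \<one>" using dvd by simp
  hence "v \<guillemotleft>f \<one>\<guillemotright> \<le> 1 / real p" using v_of_int_le_iff[of "f \<one>" 1] by simp
  moreover have "\<one> \<ominus> \<guillemotleft>f \<one>\<guillemotright> \<oplus> \<guillemotleft>f \<one>\<guillemotright> = \<one>" by (simp add: minus_eq a_assoc l_neg)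
  ultimately have "v \<one> \<le> 1 / real p"
    using f[OF one] v_add[of "\<one> \<ominus> \<guillemotleft>f \<one>\<guillemotright>" "\<guillemotleft>f \<one>\<guillemotright>"] by simp
  thus False using p1 by simp
qed

text \<open>Take a residually independent list of maximal length; the degree bounds its length.\<close>

lemma residual_generators:
  obtains Us where "set Us \<subseteq> carrier K" "\<And>u. u \<in> set Us \<Longrightarrow> v u \<le> 1"
    "\<And>x. x \<in> carrier K \<Longrightarrow> v x \<le> 1 \<Longrightarrow>
      \<exists>ns. length ns = length Us \<and> v (x \<ominus> combine (map (\<lambda>n. \<guillemotleft>n\<guillemotright>) ns) Us) \<le> 1 / real p"
proof -
  have p1: "real p > 1" using prime_gt_1_nat[OF prime_p] by simp
  obtain d where d: "dimension d (\<phi> ` carrier (Qp p)) (carrier K)"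
    using finite_degree finite_dimension_def by blast
  have bound: "length Us \<le> d" if "residually_independent Us" for Us
    using independent_length_le_dimension[OF subfield_Qp d residually_independent_imp_independent[OF that]] that
    by (simp add: residually_independent_def)
  have nil: "residually_independent []" by (simp add: residually_independent_def)
  obtain Us where Us: "residually_independent Us"
    and max: "\<And>Vs. residually_independent Vs \<Longrightarrow> length Vs \<le> length Us"
    using ex_has_greatest_nat[of residually_independent "[]" length "Suc d"] nil bound
    by (metis le_imp_less_Suc)
  have U: "set Us \<subseteq> carrier K" "\<And>u. u \<in> set Us \<Longrightarrow> v u \<le> 1"
    using Us by (auto simp: residually_independent_def)
  have "\<exists>ns. length ns = length Us \<and> v (x \<ominus> combine (map (\<lambda>n. \<guillemotleft>n\<guillemotright>) ns) Us) \<le> 1 / real p"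
    if x: "x \<in> carrier K" "v x \<le> 1" for x
  proof -
    \<comment> \<open>Maximality makes the extended list dependent modulo p. The coefficient
      \<open>m\<close> of \<open>x\<close> is prime to p, since otherwise the relation would descend
      to \<open>Us\<close>; inverting \<open>m\<close> modulo p solves for \<open>x\<close>.\<close>
    have "\<not> residually_independent (x # Us)" using max[of "x # Us"] by auto
    then obtain ms where ms: "length ms = Suc (length Us)"
      "v (combine (map (\<lambda>n. \<guillemotleft>n\<guillemotright>) ms) (x # Us)) \<le> 1 / real p" "\<not> (\<forall>n\<in>set ms. int p dvd n)"
      using U x by (auto simp: residually_independent_def)
    then obtain m ns where mns: "ms = m # ns" "length ns = length Us" by (cases ms) auto
    define y where "y = combine (map (\<lambda>n. \<guillemotleft>n\<guillemotright>) ns) Us"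
    have y: "y \<in> carrier K" unfolding y_def by (intro combine_in_carrier U) auto
    have le: "v (\<guillemotleft>m\<guillemotright> \<otimes> x \<oplus> y) \<le> 1 / real p" using ms mns by (simp add: y_def)
    have m: "\<not> int p dvd m"
    proof
      assume dvd: "int p dvd m"
      hence "v \<guillemotleft>m\<guillemotright> \<le> 1 / real p" using v_of_int_le_iff[of m 1] by simp
      hence "v (\<guillemotleft>m\<guillemotright> \<otimes> x) \<le> 1 / real p * 1"
        unfolding v_mult[OF of_int_closed x(1)] using x v_nonneg[of x] p1 by (intro mult_mono) auto
      moreover have "y = (\<guillemotleft>m\<guillemotright> \<otimes> x \<oplus> y) \<ominus> \<guillemotleft>m\<guillemotright> \<otimes> x"
        using x y of_int_closed[of m] by algebra
      ultimately have "v y \<le> 1 / real p"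
        using v_diff[of "\<guillemotleft>m\<guillemotright> \<otimes> x \<oplus> y" "\<guillemotleft>m\<guillemotright> \<otimes> x"] le x y by simp
      hence "\<forall>n\<in>set ns. int p dvd n"
        using Us mns(2) by (simp add: residually_independent_def y_def)
      thus False using ms dvd mns by simp
    qed
    hence "coprime (int p) m" using prime_p by (simp add: prime_imp_coprime)
    then obtain s t where "s * int p + t * m = 1" using bezout_int[of "int p" m]
      by (metis coprime_imp_gcd_eq_1)
    hence "\<guillemotleft>s * int p + t * m\<guillemotright> = \<one>" by simp
    hence st: "\<guillemotleft>s\<guillemotright> \<otimes> \<guillemotleft>int p\<guillemotright> \<oplus> \<guillemotleft>t\<guillemotright> \<otimes> \<guillemotleft>m\<guillemotright> = \<one>" by simp
    have "combine (map (\<lambda>n. \<guillemotleft>n\<guillemotright>) (map (\<lambda>n. - t * n) ns)) Us = \<guillemotleft>- t\<guillemotright> \<otimes> y"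
      unfolding y_def using U
      by (subst combine_r_distr) (auto simp: comp_def simp del: of_int_minus mult_minus_left)
    moreover have "x \<ominus> \<guillemotleft>- t\<guillemotright> \<otimes> y = \<guillemotleft>s\<guillemotright> \<otimes> \<guillemotleft>int p\<guillemotright> \<otimes> x \<oplus> \<guillemotleft>t\<guillemotright> \<otimes> (\<guillemotleft>m\<guillemotright> \<otimes> x \<oplus> y)"
    proof -
      have "x = (\<guillemotleft>s\<guillemotright> \<otimes> \<guillemotleft>int p\<guillemotright> \<oplus> \<guillemotleft>t\<guillemotright> \<otimes> \<guillemotleft>m\<guillemotright>) \<otimes> x" using st x by simp
      hence "x \<ominus> \<guillemotleft>- t\<guillemotright> \<otimes> y = (\<guillemotleft>s\<guillemotright> \<otimes> \<guillemotleft>int p\<guillemotright> \<oplus> \<guillemotleft>t\<guillemotright> \<otimes> \<guillemotleft>m\<guillemotright>) \<otimes> x \<oplus> \<guillemotleft>t\<guillemotright> \<otimes> y"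
        using x y by (simp add: minus_eq l_minus)
      also have "\<dots> = \<guillemotleft>s\<guillemotright> \<otimes> \<guillemotleft>int p\<guillemotright> \<otimes> x \<oplus> \<guillemotleft>t\<guillemotright> \<otimes> (\<guillemotleft>m\<guillemotright> \<otimes> x \<oplus> y)"
        using x y of_int_closed[of s] of_int_closed[of t] of_int_closed[of m] of_int_closed[of "int p"]
        by algebra
      finally show ?thesis .
    qed
    moreover have "v (\<guillemotleft>s\<guillemotright> \<otimes> \<guillemotleft>int p\<guillemotright> \<otimes> x) \<le> 1 / real p"
    proof -
      have "v (\<guillemotleft>s\<guillemotright> \<otimes> \<guillemotleft>int p\<guillemotright> \<otimes> x) = v \<guillemotleft>s\<guillemotright> * (1 / real p) * v x"
        using x v_of_int_prime_power[of 1] by (simp add: v_mult)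
      also have "\<dots> \<le> 1 * (1 / real p) * 1"
        using x v_nonneg[of x] v_nonneg[of "\<guillemotleft>s\<guillemotright>"] v_of_int_le_1[of s] p1
        by (intro mult_mono) auto
      finally show ?thesis by simp
    qed
    moreover have "v (\<guillemotleft>t\<guillemotright> \<otimes> (\<guillemotleft>m\<guillemotright> \<otimes> x \<oplus> y)) \<le> 1 * (1 / real p)"
      using le x y by (intro v_mult_le v_of_int_le_1) auto
    ultimately have "v (x \<ominus> combine (map (\<lambda>n. \<guillemotleft>n\<guillemotright>) (map (\<lambda>n. - t * n) ns)) Us) \<le> 1 / real p"
      using x y v_add[of "\<guillemotleft>s\<guillemotright> \<otimes> \<guillemotleft>int p\<guillemotright> \<otimes> x" "\<guillemotleft>t\<guillemotright> \<otimes> (\<guillemotleft>m\<guillemotright> \<otimes> x \<oplus> y)"]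
      by (simp del: of_int_minus)
    thus ?thesis using mns(2) by (intro exI[of _ "map (\<lambda>n. - t * n) ns"]) auto
  qed
  thus ?thesis using that U by blast
qed

section \<open>Finite nets, division by powers of p, and limits\<close>

lemma p_gt_1: "real p > 1"
  using prime_gt_1_nat[OF prime_p] by simp

lemma v_of_int_diff_le_iff: "v (\<guillemotleft>m\<guillemotright> \<ominus> \<guillemotleft>n\<guillemotright>) \<le> (1 / real p) ^ k \<longleftrightarrow> int p ^ k dvd m - n"
  using v_of_int_le_iff[of "m - n"] by simp

text \<open>Only the coefficients modulo p matter, and there are finitely many lists of
  remainders.\<close>

lemma finite_net_Suc_0:
  obtains T where "finite T" "T \<subseteq> carrier K" "\<And>t. t \<in> T \<Longrightarrow> v t \<le> 1"
    "\<And>x. x \<in> carrier K \<Longrightarrow> v x \<le> 1 \<Longrightarrow> \<exists>t\<in>T. v (x \<ominus> t) \<le> 1 / real p"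
proof -
  obtain Us where U: "set Us \<subseteq> carrier K" "\<And>u. u \<in> set Us \<Longrightarrow> v u \<le> 1"
    and gen: "\<And>x. x \<in> carrier K \<Longrightarrow> v x \<le> 1 \<Longrightarrow>
      \<exists>ns. length ns = length Us \<and> v (x \<ominus> combine (map (\<lambda>n. \<guillemotleft>n\<guillemotright>) ns) Us) \<le> 1 / real p"
    using residual_generators by blast
  define C where "C = (\<lambda>ns. combine (map (\<lambda>n. \<guillemotleft>n\<guillemotright>) ns) Us)"
  have C: "C ns \<in> carrier K" "v (C ns) \<le> 1" for ns
    unfolding C_def using U v_of_int_le_1 by (auto intro!: combine_in_carrier v_combine_le_1)
  define T where "T = C ` {ns. set ns \<subseteq> {0..<int p} \<and> length ns = length Us}"
  show ?thesis
  proof (rule that[of T])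
    show "finite T" unfolding T_def by (intro finite_imageI finite_lists_length_eq) simp
    show "T \<subseteq> carrier K" "\<And>t. t \<in> T \<Longrightarrow> v t \<le> 1" using C by (auto simp: T_def)
    fix x assume x: "x \<in> carrier K" "v x \<le> 1"
    obtain ns where ns: "length ns = length Us" "v (x \<ominus> C ns) \<le> 1 / real p"
      using gen[OF x] unfolding C_def by blast
    let ?ms = "map (\<lambda>n. n mod int p) ns"
    have "int p dvd n - n mod int p" for n by (simp add: minus_mod_eq_mult_div)
    hence "v (\<guillemotleft>n\<guillemotright> \<ominus> \<guillemotleft>n mod int p\<guillemotright>) \<le> 1 / real p" for n
      using v_of_int_diff_le_iff[of n "n mod int p" 1] by simp
    hence "v (C ns \<ominus> C ?ms) \<le> 1 / real p"
      unfolding C_def by (intro v_combine_diff U) (auto simp: list_all2_conv_all_nth)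
    hence "v (x \<ominus> C ?ms) \<le> 1 / real p" using v_diff_trans[OF x(1) C(1) C(1) ns(2)] by blast
    moreover have "C ?ms \<in> T"
      unfolding T_def using ns prime_gt_0_nat[OF prime_p] by (intro imageI) auto
    ultimately show "\<exists>t\<in>T. v (x \<ominus> t) \<le> 1 / real p" by blast
  qed
qed

text \<open>The image of p^k has absolute value exactly p^-k, so the quotient is again integral; p
  plays the part of a uniformizer in all iterations.\<close>

lemma divide_prime_power:
  assumes x: "x \<in> carrier K" "v x \<le> (1 / real p) ^ k"
  obtains y where "y \<in> carrier K" "v y \<le> 1" "x = \<guillemotleft>int p ^ k\<guillemotright> \<otimes> y"
proof -
  let ?q = "\<guillemotleft>int p ^ k\<guillemotright>"
  have q: "?q \<in> carrier K" "v ?q = (1 / real p) ^ k" using v_of_int_prime_power by (auto simp del: of_int_power)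
  have q0: "?q \<noteq> \<zero>" using q p_gt_1 v_eq_0_iff[OF q(1)] by auto
  show ?thesis
  proof (rule that[of "inv ?q \<otimes> x"])
    show "inv ?q \<otimes> x \<in> carrier K" using q q0 x by (simp del: of_int_power)
    have "v (inv ?q \<otimes> x) = real p ^ k * v x"
      using q q0 x by (simp add: v_mult v_inv power_one_over field_simps del: of_int_power)
    also have "\<dots> \<le> real p ^ k * (1 / real p) ^ k" using x by (intro mult_left_mono) auto
    also have "\<dots> = 1" using p_gt_1 by (simp add: power_one_over)
    finally show "v (inv ?q \<otimes> x) \<le> 1" .
    show "x = ?q \<otimes> (inv ?q \<otimes> x)" using q q0 x by (simp add: m_assoc[symmetric] del: of_int_power)
  qed
qed

text \<open>Once the error at scale p^-k is divided by p^k it is integral again, so p^k times a net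
  of scale 1 / p refines every point of the coarser net.\<close>

lemma finite_net:
  obtains T where "finite T" "T \<subseteq> carrier K" "\<And>t. t \<in> T \<Longrightarrow> v t \<le> 1"
    "\<And>x. x \<in> carrier K \<Longrightarrow> v x \<le> 1 \<Longrightarrow> \<exists>t\<in>T. v (x \<ominus> t) \<le> (1 / real p) ^ k"
proof (induction k arbitrary: thesis)
  case 0
  show ?case by (rule 0[of "{\<zero>}"]) (auto simp: minus_eq)
next
  case (Suc k)
  obtain T where T: "finite T" "T \<subseteq> carrier K" "\<And>t. t \<in> T \<Longrightarrow> v t \<le> 1"
    "\<And>x. x \<in> carrier K \<Longrightarrow> v x \<le> 1 \<Longrightarrow> \<exists>t\<in>T. v (x \<ominus> t) \<le> (1 / real p) ^ k" by (rule Suc.IH) blast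
  obtain S where S: "finite S" "S \<subseteq> carrier K" "\<And>s. s \<in> S \<Longrightarrow> v s \<le> 1"
    "\<And>x. x \<in> carrier K \<Longrightarrow> v x \<le> 1 \<Longrightarrow> \<exists>s\<in>S. v (x \<ominus> s) \<le> 1 / real p" by (rule finite_net_Suc_0) blast
  let ?q = "\<guillemotleft>int p ^ k\<guillemotright>"
  have q: "?q \<in> carrier K" "v ?q = (1 / real p) ^ k" "v ?q \<le> 1"
    using v_of_int_prime_power v_of_int_le_1[of "int p ^ k"] by (auto simp del: of_int_power)
  show ?case
  proof (rule Suc.prems[of "(\<lambda>(t, s). t \<oplus> ?q \<otimes> s) ` (T \<times> S)"])
    show "finite ((\<lambda>(t, s). t \<oplus> ?q \<otimes> s) ` (T \<times> S))" using T S by blast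
    show "(\<lambda>(t, s). t \<oplus> ?q \<otimes> s) ` (T \<times> S) \<subseteq> carrier K"
      using T(2) S(2) q by (auto simp: subset_iff simp del: of_int_power)
    show "v t \<le> 1" if t: "t \<in> (\<lambda>(t, s). t \<oplus> ?q \<otimes> s) ` (T \<times> S)" for t
    proof -
      obtain a s where as: "a \<in> T" "s \<in> S" "t = a \<oplus> ?q \<otimes> s"
        using t by (auto simp del: of_int_power)
      have K: "a \<in> carrier K" "s \<in> carrier K" using as T S by auto
      have "v (?q \<otimes> s) \<le> 1 * 1" using as q S K by (intro v_mult_le) auto
      thus ?thesis unfolding as(3) using v_add[of a "?q \<otimes> s"] T(3)[OF as(1)] K q
        by (simp del: of_int_power)
    qed
    fix x assume x: "x \<in> carrier K" "v x \<le> 1"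
    obtain t where t: "t \<in> T" "v (x \<ominus> t) \<le> (1 / real p) ^ k" using T(4)[OF x] by blast
    have tK: "t \<in> carrier K" using t T by blast
    obtain y where y: "y \<in> carrier K" "v y \<le> 1" "x \<ominus> t = ?q \<otimes> y"
      by (rule divide_prime_power[of "x \<ominus> t" k]) (use t x tK in auto)
    obtain s where s: "s \<in> S" "v (y \<ominus> s) \<le> 1 / real p" using S(4)[OF y(1,2)] by blast
    have sK: "s \<in> carrier K" using s S by blast
    have "x \<ominus> (t \<oplus> ?q \<otimes> s) = (x \<ominus> t) \<ominus> ?q \<otimes> s" using x tK q sK by algebra
    also have "\<dots> = ?q \<otimes> (y \<ominus> s)" unfolding y(3) using q y(1) sK by algebra
    finally have "v (x \<ominus> (t \<oplus> ?q \<otimes> s)) = (1 / real p) ^ k * v (y \<ominus> s)"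
      using q y sK by (simp add: v_mult del: of_int_power)
    also have "\<dots> \<le> (1 / real p) ^ k * (1 / real p)" using s by (intro mult_left_mono) auto
    finally show "\<exists>t\<in>(\<lambda>(t, s). t \<oplus> ?q \<otimes> s) ` (T \<times> S). v (x \<ominus> t) \<le> (1 / real p) ^ Suc k"
      using t s by (auto simp del: of_int_power simp: mult.commute)
  qed
qed

text \<open>Approximate each term by an integer combination of the generators. Consecutive
  coefficient lists can be chosen congruent modulo p^k, so each coordinate is a p-adically Cauchy
  sequence of integers with a limit in the image of \<open>Qp p\<close>; combining these limits
  gives \<open>l\<close>.\<close>

lemma v_complete:
  assumes y: "\<And>k. y k \<in> carrier K" "\<And>k. v (y k) \<le> 1"
    and diff: "\<And>k. v (y (Suc k) \<ominus> y k) \<le> (1 / real p) ^ k"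
  obtains l where "l \<in> carrier K" "v l \<le> 1" "\<And>k. v (l \<ominus> y k) \<le> (1 / real p) ^ k"
proof -
  obtain Us where U: "set Us \<subseteq> carrier K" "\<And>u. u \<in> set Us \<Longrightarrow> v u \<le> 1"
    and gen: "\<And>x. x \<in> carrier K \<Longrightarrow> v x \<le> 1 \<Longrightarrow>
      \<exists>ns. length ns = length Us \<and> v (x \<ominus> combine (map (\<lambda>n. \<guillemotleft>n\<guillemotright>) ns) Us) \<le> 1 / real p"
    using residual_generators by blast
  define C where "C = (\<lambda>ns. combine (map (\<lambda>n. \<guillemotleft>n\<guillemotright>) ns) Us)"
  have C: "C ns \<in> carrier K" "v (C ns) \<le> 1" for ns
    unfolding C_def using U v_of_int_le_1 by (auto intro!: combine_in_carrier v_combine_le_1)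
  have "\<exists>N. \<forall>k. (length (N k) = length Us \<and> v (y k \<ominus> C (N k)) \<le> (1 / real p) ^ k) \<and>
    (\<forall>i<length Us. int p ^ k dvd N (Suc k) ! i - N k ! i)"
  proof (rule dependent_nat_choice)
    show "\<exists>ns. length ns = length Us \<and> v (y 0 \<ominus> C ns) \<le> (1 / real p) ^ 0"
      using v_diff[OF y(1)[of 0] C(1)[of "replicate (length Us) 0"]] y(2)[of 0] C(2)[of "replicate (length Us) 0"]
      by (intro exI[of _ "replicate (length Us) 0"]) auto
    fix ns k assume ns: "length ns = length Us \<and> v (y k \<ominus> C ns) \<le> (1 / real p) ^ k"
    let ?q = "\<guillemotleft>int p ^ k\<guillemotright>"
    have q: "?q \<in> carrier K" "v ?q = (1 / real p) ^ k"
      using v_of_int_prime_power by (auto simp del: of_int_power)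
    have "v (y (Suc k) \<ominus> C ns) \<le> (1 / real p) ^ k"
      using v_diff_trans[OF y(1) y(1) C(1) diff] ns by blast
    then obtain z where z: "z \<in> carrier K" "v z \<le> 1" "y (Suc k) \<ominus> C ns = ?q \<otimes> z"
      by (rule divide_prime_power[rotated]) (use y C in auto)
    obtain ms where ms: "length ms = length Us" "v (z \<ominus> C ms) \<le> 1 / real p"
      using gen[OF z(1,2)] unfolding C_def by blast
    \<comment> \<open>The old coefficients are corrected by p^k times the digits of the normalized
      error \<open>z\<close>: this gains a factor p and changes coefficients only by multiples of
      p^k.\<close>
    define ns' where "ns' = map2 (+) ns (map (\<lambda>m. int p ^ k * m) ms)"
    have "C (map (\<lambda>m. int p ^ k * m) ms) = ?q \<otimes> C ms"
      unfolding C_def using U q by (subst combine_r_distr) (auto simp: comp_def simp del: of_int_power)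
    moreover have "C ns \<oplus> C (map (\<lambda>m. int p ^ k * m) ms) = C ns'"
      unfolding C_def ns'_def using U ns ms
      by (subst combine_add) (auto simp: map2_map_map zip_map1 zip_map2 case_prod_unfold comp_def intro!: arg_cong2[of _ _ _ _ combine])
    ultimately have "C ns' = C ns \<oplus> ?q \<otimes> C ms" by simp
    hence "y (Suc k) \<ominus> C ns' = (y (Suc k) \<ominus> C ns) \<ominus> ?q \<otimes> C ms" using y(1)[of "Suc k"] C(1) q by algebra
    also have "\<dots> = ?q \<otimes> (z \<ominus> C ms)" unfolding z(3) using q z(1) C(1) by algebra
    finally have "v (y (Suc k) \<ominus> C ns') = (1 / real p) ^ k * v (z \<ominus> C ms)"
      using q z C by (simp add: v_mult del: of_int_power)
    also have "\<dots> \<le> (1 / real p) ^ k * (1 / real p)" using ms by (intro mult_left_mono) auto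
    finally have "v (y (Suc k) \<ominus> C ns') \<le> (1 / real p) ^ Suc k" by (simp add: mult.commute)
    moreover have "length ns' = length Us" "\<forall>i<length Us. int p ^ k dvd ns' ! i - ns ! i"
      using ns ms by (auto simp: ns'_def)
    ultimately show "\<exists>ns'. (length ns' = length Us \<and> v (y (Suc k) \<ominus> C ns') \<le> (1 / real p) ^ Suc k) \<and>
      (\<forall>i<length Us. int p ^ k dvd ns' ! i - ns ! i)" by blast
  qed
  then obtain N where N: "\<And>k. length (N k) = length Us" "\<And>k. v (y k \<ominus> C (N k)) \<le> (1 / real p) ^ k"
    "\<And>k i. i < length Us \<Longrightarrow> int p ^ k dvd N (Suc k) ! i - N k ! i" by blast
  have N_dvd: "int p ^ k dvd N m ! i - N k ! i" if "m \<ge> k" "i < length Us" for m k i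
    using that(1)
  proof (induction m rule: dec_induct)
    case base then show ?case by simp
  next
    case (step m)
    have "int p ^ k dvd N (Suc m) ! i - N m ! i"
      using N(3)[OF that(2), of m] step(1) le_imp_power_dvd dvd_trans by blast
    from dvd_add[OF this step.IH] show ?case by simp
  qed
  define X where "X = (\<lambda>i k. rat_of_int (N k ! i))"
  have X_diff: "padic_abs p (X i m - X i k) \<le> (1 / real p) ^ k" if "m \<ge> k" "i < length Us" for m k i
    using padic_abs_of_int_le_iff[OF prime_p, of "N m ! i - N k ! i" k] N_dvd[OF that] by (simp add: X_def)
  have X: "X i \<in> padic_Cauchy_seqs p" if i: "i < length Us" for i
    unfolding padic_Cauchy_seqs_def
  proof (intro CollectI allI impI)
    fix e :: real assume "e > 0"
    then obtain k where k: "(1 / real p) ^ k < e" using real_arch_pow_inv[of e "1 / real p"] p_gt_1 by auto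
    have "padic_abs p (X i m - X i n) < e" if "m \<ge> k" "n \<ge> k" for m n
    proof -
      have "X i m - X i n = (X i m - X i k) - (X i n - X i k)" by simp
      hence "padic_abs p (X i m - X i n) \<le> max (padic_abs p (X i m - X i k)) (padic_abs p (X i n - X i k))"
        using padic_abs_diff[OF prime_p] by metis
      thus ?thesis using X_diff[OF that(1) i] X_diff[OF that(2) i] k by linarith
    qed
    thus "\<exists>M. \<forall>m\<ge>M. \<forall>n\<ge>M. padic_abs p (X i m - X i n) < e" by blast
  qed
  have XN: "v (padic_embed (X i) \<ominus> \<guillemotleft>N k ! i\<guillemotright>) \<le> (1 / real p) ^ k" if i: "i < length Us" for i k
    by (rule padic_embed_diff_le[OF X[OF i], of k]) (use X_diff[OF _ i] in \<open>auto simp: X_def\<close>)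
  define l where "l = combine (map (\<lambda>i. padic_embed (X i)) [0..<length Us]) Us"
  have lK: "l \<in> carrier K" unfolding l_def using U X by (intro combine_in_carrier) auto
  have lN: "v (l \<ominus> C (N k)) \<le> (1 / real p) ^ k" for k
    unfolding l_def C_def using U X XN N by (intro v_combine_diff) (auto simp: list_all2_conv_all_nth)
  have ly: "v (l \<ominus> y k) \<le> (1 / real p) ^ k" for k
    using v_diff_trans[OF lK C(1) y(1) lN] N(2)[of k] v_diff_commute[OF y(1) C(1)] by metis
  have "l = (l \<ominus> y 0) \<oplus> y 0" using lK y(1)[of 0] by algebra
  hence "v l \<le> 1" using v_add[of "l \<ominus> y 0" "y 0"] ly[of 0] y(2)[of 0] y(1)[of 0] lK
    by (metis max.bounded_iff minus_closed order_trans power_0)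
  thus ?thesis using that lK ly by blast
qed

section \<open>Square roots\<close>

lemma v_add_eq:
  assumes "x \<in> carrier K" "y \<in> carrier K" "v y < v x"
  shows "v (x \<oplus> y) = v x"
proof -
  have "x = (x \<oplus> y) \<ominus> y" using assms(1,2) by algebra
  hence "v x \<le> max (v (x \<oplus> y)) (v y)" using v_diff[of "x \<oplus> y" y] assms by simp
  thus ?thesis using v_add[OF assms(1,2)] assms(3) by simp
qed

lemma v_one_unit:
  assumes "x \<in> carrier K" "v (x \<ominus> \<one>) < 1"
  shows "v x = 1"
proof -
  have "x = \<one> \<oplus> (x \<ominus> \<one>)" using assms(1) by algebra
  thus ?thesis using v_add_eq[of \<one> "x \<ominus> \<one>"] assms by simp
qed

lemma v_2: "p \<noteq> 2 \<Longrightarrow> v \<guillemotleft>2\<guillemotright> = 1"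
  using prime_p v_of_int_coprime[of 2] prime_gt_1_nat[OF prime_p] zdvd_imp_le[of "int p" 2] by fastforce

text \<open>Newton iteration with correction \<open>t = (y * y - x) / (2 * y)\<close>: the linear
  terms cancel and the new error is \<open>t * t\<close>. As 2 and \<open>y\<close> are units, the
  error is squared, of which only one further factor \<open>v (x \<ominus> \<one>)\<close> is
  recorded. Closeness to 1 is carried along to keep \<open>y\<close> a unit.\<close>

lemma one_unit_sqrt_approx:
  assumes p2: "p \<noteq> 2" and x: "x \<in> carrier K" "v (x \<ominus> \<one>) < 1"
  shows "\<exists>y\<in>carrier K. v (y \<ominus> \<one>) \<le> v (x \<ominus> \<one>) \<and> v (y \<otimes> y \<ominus> x) \<le> v (x \<ominus> \<one>) ^ Suc n"
proof (induction n)
  case 0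
  show ?case using x v_diff_commute[of x \<one>]
    by (intro bexI[of _ \<one>]) (auto simp: v_nonneg minus_eq r_neg)
next
  case (Suc n)
  let ?e = "v (x \<ominus> \<one>)"
  have e: "0 \<le> ?e" using v_nonneg x by simp
  obtain y where y: "y \<in> carrier K" "v (y \<ominus> \<one>) \<le> ?e" "v (y \<otimes> y \<ominus> x) \<le> ?e ^ Suc n" using Suc by blast
  have vy: "v y = 1" using v_one_unit[OF y(1)] y x by simp
  define w where "w = \<guillemotleft>2\<guillemotright> \<otimes> y"
  have w: "w \<in> carrier K" "v w = 1" using y vy v_2[OF p2] by (simp_all add: w_def v_mult)
  have w0: "w \<noteq> \<zero>" using w by auto
  define t where "t = inv w \<otimes> (y \<otimes> y \<ominus> x)"
  have t: "t \<in> carrier K" using w w0 y x by (simp add: t_def)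
  have vt: "v t = v (y \<otimes> y \<ominus> x)" using w w0 y x by (simp add: t_def v_mult v_inv)
  have wt: "w \<otimes> t = y \<otimes> y \<ominus> x" unfolding t_def using w w0 y x by (simp add: m_assoc[symmetric])
  have w2: "w = y \<oplus> y" using y by (simp add: w_def of_int_2 l_distr)
  have "(y \<ominus> t) \<otimes> (y \<ominus> t) \<ominus> x = (y \<otimes> y \<ominus> x) \<ominus> w \<otimes> t \<oplus> t \<otimes> t"
    unfolding w2 using y(1) t x(1) by algebra
  also have "\<dots> = t \<otimes> t" unfolding wt using y(1) x(1) t by algebra
  finally have "v ((y \<ominus> t) \<otimes> (y \<ominus> t) \<ominus> x) = v (y \<otimes> y \<ominus> x) * v (y \<otimes> y \<ominus> x)"
    using t vt by (simp add: v_mult)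
  also have "\<dots> \<le> ?e * ?e ^ Suc n"
  proof (intro mult_mono)
    have "?e ^ Suc n \<le> ?e" using e x by (simp add: mult_left_le power_le_one)
    thus "v (y \<otimes> y \<ominus> x) \<le> ?e" using y(3) by linarith
  qed (use y e x v_nonneg in auto)
  finally have 1: "v ((y \<ominus> t) \<otimes> (y \<ominus> t) \<ominus> x) \<le> ?e ^ Suc (Suc n)" by simp
  have "v t \<le> ?e" using vt y(3) e x by (simp add: mult_left_le power_le_one order_trans)
  moreover have "(y \<ominus> t) \<ominus> \<one> = (y \<ominus> \<one>) \<ominus> t" using y(1) t by algebra
  ultimately have "v ((y \<ominus> t) \<ominus> \<one>) \<le> ?e" using v_diff[of "y \<ominus> \<one>" t] y t by simp
  thus ?case using 1 y t by (intro bexI[of _ "y \<ominus> t"]) auto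
qed

text \<open>Approximate roots are chosen separately for each precision, so their coherence must be
  recovered: both are close to 1, their sum is close to 2 and hence a unit, and
  \<open>(a \<ominus> b) \<otimes> (a \<oplus> b)\<close> is the difference of two small
  errors.\<close>

lemma one_unit_square:
  assumes p2: "p \<noteq> 2" and x: "x \<in> carrier K" "v (x \<ominus> \<one>) < 1"
  obtains y where "y \<in> carrier K" "y \<otimes> y = x"
proof -
  let ?e = "v (x \<ominus> \<one>)"
  have e: "0 \<le> ?e" using v_nonneg x by simp
  have "\<exists>y. y \<in> carrier K \<and> v (y \<ominus> \<one>) < 1 \<and> v (y \<otimes> y \<ominus> x) \<le> (1 / real p) ^ k" for k
  proof -
    have "0 < (1 / real p) ^ k" using p_gt_1 by simp
    \<comment> \<open>In a ramified extension \<open>?e\<close> may exceed 1 / p, so the number of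
      Newton steps needed for precision p^-k comes from the Archimedean property.\<close>
    then obtain n where n: "?e ^ n < (1 / real p) ^ k" using real_arch_pow_inv x by blast
    have "?e ^ Suc n \<le> ?e ^ n" using e x by (intro power_decreasing) auto
    thus ?thesis using one_unit_sqrt_approx[OF p2 x, of n] n x by (meson order.strict_trans1 order_trans less_imp_le)
  qed
  then obtain Y where Y: "\<And>k. Y k \<in> carrier K" "\<And>k. v (Y k \<ominus> \<one>) < 1"
    "\<And>k. v (Y k \<otimes> Y k \<ominus> x) \<le> (1 / real p) ^ k" by metis
  have vY: "v (Y k) = 1" for k using v_one_unit[OF Y(1,2)] .
  have "v (Y (Suc k) \<ominus> Y k) \<le> (1 / real p) ^ k" for k
  proof -
    define a b where "a = Y (Suc k)" and "b = Y k"
    have ab: "a \<in> carrier K" "b \<in> carrier K" "v (a \<ominus> \<one>) < 1" "v (b \<ominus> \<one>) < 1" using Y by (auto simp: a_def b_def)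
    have "a \<oplus> b = (\<one> \<oplus> \<one>) \<oplus> ((a \<ominus> \<one>) \<oplus> (b \<ominus> \<one>))" using ab(1,2) by algebra
    moreover have "v ((a \<ominus> \<one>) \<oplus> (b \<ominus> \<one>)) < 1"
      using ab v_add[of "a \<ominus> \<one>" "b \<ominus> \<one>"] by simp
    ultimately have "v (a \<oplus> b) = 1"
      using v_add_eq[of "\<one> \<oplus> \<one>" "(a \<ominus> \<one>) \<oplus> (b \<ominus> \<one>)"] v_2[OF p2] ab by (simp add: of_int_2)
    hence "v (a \<ominus> b) = v ((a \<ominus> b) \<otimes> (a \<oplus> b))" using ab by (simp add: v_mult)
    also have "(a \<ominus> b) \<otimes> (a \<oplus> b) = (a \<otimes> a \<ominus> x) \<ominus> (b \<otimes> b \<ominus> x)" using ab(1,2) x(1) by algebra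
    also have "v \<dots> \<le> max (v (a \<otimes> a \<ominus> x)) (v (b \<otimes> b \<ominus> x))" using ab x by (intro v_diff) auto
    also have "\<dots> \<le> (1 / real p) ^ k"
    proof -
      have "(1 / real p) ^ Suc k \<le> (1 / real p) ^ k" using p_gt_1 by (intro power_decreasing) auto
      thus ?thesis using Y(3)[of k] Y(3)[of "Suc k"] by (simp add: a_def b_def)
    qed
    finally show ?thesis by (simp add: a_def b_def)
  qed
  then obtain l where l: "l \<in> carrier K" "v l \<le> 1" "\<And>k. v (l \<ominus> Y k) \<le> (1 / real p) ^ k"
    using v_complete[of Y] Y vY by (metis order_refl)
  have le: "v (l \<otimes> l \<ominus> x) \<le> (1 / real p) ^ k" for k
  proof -
    have Yk: "Y k \<in> carrier K" by (rule Y)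
    have "l \<otimes> l \<ominus> x = (l \<ominus> Y k) \<otimes> (l \<oplus> Y k) \<oplus> (Y k \<otimes> Y k \<ominus> x)" using l(1) Yk x(1) by algebra
    moreover have "v ((l \<ominus> Y k) \<otimes> (l \<oplus> Y k)) \<le> (1 / real p) ^ k * 1"
      using v_add[OF l(1) Yk] l(1,2) l(3)[of k] Yk vY[of k] by (intro v_mult_le) auto
    ultimately show ?thesis
      using v_add[of "(l \<ominus> Y k) \<otimes> (l \<oplus> Y k)" "Y k \<otimes> Y k \<ominus> x"] Y(3)[of k] l Yk x by simp
  qed
  have "v (l \<otimes> l \<ominus> x) = 0"
  proof (rule ccontr)
    assume "v (l \<otimes> l \<ominus> x) \<noteq> 0"
    hence "v (l \<otimes> l \<ominus> x) > 0" using v_nonneg[of "l \<otimes> l \<ominus> x"] l x by simp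
    then obtain k where "(1 / real p) ^ k < v (l \<otimes> l \<ominus> x)"
      using real_arch_pow_inv[of _ "1 / real p"] p_gt_1 by auto
    thus False using le[of k] by simp
  qed
  hence "l \<otimes> l = x" using v_eq_0_iff l x eq_diff0 by simp
  thus ?thesis using that l by blast
qed

end

section \<open>Quadratic characters of finite fields\<close>

context field
begin

definition nonzero_squares :: "'a set" where
  "nonzero_squares = {x \<in> carrier R - {\<zero>}. \<exists>y\<in>carrier R. x = y \<otimes> y}"

definition qchar :: "'a \<Rightarrow> real" where
  "qchar x = (if x = \<zero> then 0 else if x \<in> nonzero_squares then 1 else -1)"

lemma abs_qchar_le_1: "\<bar>qchar x\<bar> \<le> 1"
  by (simp add: qchar_def)

lemma qchar_mult_square:
  assumes "x \<in> nonzero_squares" "z \<in> carrier R"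
  shows "qchar (x \<otimes> z) = qchar z"
proof -
  obtain y where y: "y \<in> carrier R" "x = y \<otimes> y" and x: "x \<in> carrier R" "x \<noteq> \<zero>"
    using assms by (auto simp: nonzero_squares_def)
  have y0: "y \<noteq> \<zero>" using x y by auto
  have "x \<otimes> z \<in> nonzero_squares \<longleftrightarrow> z \<in> nonzero_squares"
  proof
    assume "x \<otimes> z \<in> nonzero_squares"
    then obtain w where w: "w \<in> carrier R" "x \<otimes> z = w \<otimes> w" and 0: "x \<otimes> z \<noteq> \<zero>"
      by (auto simp: nonzero_squares_def)
    have "z = (inv y \<otimes> inv y) \<otimes> (y \<otimes> y) \<otimes> z"
      using y y0 assms by (simp add: m_assoc) (simp add: m_assoc[symmetric])
    also have "\<dots> = (inv y \<otimes> inv y) \<otimes> (x \<otimes> z)" using y y0 assms by (simp add: m_assoc)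
    also have "\<dots> = (inv y \<otimes> w) \<otimes> (inv y \<otimes> w)" unfolding w(2) using y y0 w(1) by (simp add: m_ac)
    finally show "z \<in> nonzero_squares"
      using 0 w y y0 x assms unfolding nonzero_squares_def
      by (intro CollectI conjI bexI[of _ "inv y \<otimes> w"]) auto
  next
    assume "z \<in> nonzero_squares"
    then obtain w where w: "w \<in> carrier R" "z = w \<otimes> w" and 0: "z \<noteq> \<zero>"
      by (auto simp: nonzero_squares_def)
    show "x \<otimes> z \<in> nonzero_squares"
      using w y x 0 assms unfolding nonzero_squares_def
      by (intro CollectI conjI bexI[of _ "y \<otimes> w"]) (auto simp: integral_iff m_ac)
  qed
  thus ?thesis using x assms by (simp add: qchar_def integral_iff)
qed

lemma one_nonzero_square: "\<one> \<in> nonzero_squares"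
  unfolding nonzero_squares_def by (auto intro!: bexI[of _ \<one>])

text \<open>For \<open>b = \<zero>\<close> the equation reads \<open>r = \<zero>\<close> and has no
  solution; otherwise \<open>b\<close> cancels.\<close>

lemma card_root_le_1:
  assumes "b \<in> carrier R" "r \<in> carrier R" "r \<noteq> \<zero>"
  shows "card {c \<in> carrier R. b \<otimes> c \<oplus> r = \<zero>} \<le> 1"
proof -
  have single: "card A \<le> 1" if "\<And>c d. c \<in> A \<Longrightarrow> d \<in> A \<Longrightarrow> c = d" for A :: "'a set"
  proof (cases "A = {}")
    case False
    then obtain d where "d \<in> A" by blast
    hence "A = {d}" using that by blast
    thus ?thesis by simp
  qed simp
  show ?thesis
  proof (rule single)
    fix c d assume "c \<in> {c \<in> carrier R. b \<otimes> c \<oplus> r = \<zero>}" "d \<in> {c \<in> carrier R. b \<otimes> c \<oplus> r = \<zero>}"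
    hence cd: "c \<in> carrier R" "d \<in> carrier R" "b \<otimes> c \<oplus> r = \<zero>" "b \<otimes> d \<oplus> r = \<zero>" by auto
    have b0: "b \<noteq> \<zero>" using cd assms by auto
    have "b \<otimes> c \<oplus> r = b \<otimes> d \<oplus> r" using cd by simp
    hence "b \<otimes> c = b \<otimes> d" using cd(1,2) assms by simp
    thus "c = d" using m_lcancel[OF b0] cd(1,2) assms by simp
  qed
qed

end

section \<open>Sums of the quadratic character over linear forms\<close>

locale odd_finite_field = field +
  assumes finite_carrier: "finite (carrier R)" and two_neq_0: "\<one> \<oplus> \<one> \<noteq> \<zero>"
begin

text \<open>Squaring is two-to-one on nonzero elements: \<open>x\<close> and
  \<open>\<ominus> x\<close> differ because 2 is nonzero.\<close>

lemma card_nonzero_squares: "2 * card nonzero_squares = card (carrier R - {\<zero>})"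
proof -
  have "card (carrier R - {\<zero>}) = (\<Sum>x\<in>carrier R - {\<zero>}. 1)" by simp
  also have "\<dots> = (\<Sum>s\<in>(\<lambda>y. y \<otimes> y) ` (carrier R - {\<zero>}). \<Sum>y | y \<in> carrier R - {\<zero>} \<and> y \<otimes> y = s. 1)"
    using finite_carrier by (intro sum.image_gen) auto
  also have "(\<lambda>y. y \<otimes> y) ` (carrier R - {\<zero>}) = nonzero_squares"
    by (auto simp: nonzero_squares_def integral_iff)
  also have "(\<Sum>s\<in>nonzero_squares. \<Sum>y | y \<in> carrier R - {\<zero>} \<and> y \<otimes> y = s. 1) = (\<Sum>s\<in>nonzero_squares. (2::nat))"
  proof (rule sum.cong)
    fix s assume "s \<in> nonzero_squares"
    then obtain x where x: "x \<in> carrier R" "s = x \<otimes> x" "s \<noteq> \<zero>" by (auto simp: nonzero_squares_def)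
    have x0: "x \<noteq> \<zero>" using x by auto
    have "{y. y \<in> carrier R - {\<zero>} \<and> y \<otimes> y = s} = {x, \<ominus> x}"
      using x x0 by (auto simp: square_eq_iff integral_iff)
    moreover have "x \<noteq> \<ominus> x"
    proof
      assume "x = \<ominus> x"
      hence "(\<one> \<oplus> \<one>) \<otimes> x = \<zero>" using x eq_neg_iff_add_eq_0[of x x] by (simp add: l_distr)
      thus False using x x0 two_neq_0 by (simp add: integral_iff)
    qed
    ultimately show "(\<Sum>y | y \<in> carrier R - {\<zero>} \<and> y \<otimes> y = s. 1) = (2::nat)" by simp
  qed simp
  finally show ?thesis by simp
qed

lemma finite_nonzero_squares: "finite nonzero_squares"
  using finite_carrier by (simp add: nonzero_squares_def)

lemma card_nonsquares: "card (carrier R - {\<zero>} - nonzero_squares) = card nonzero_squares"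
  using card_nonzero_squares finite_nonzero_squares
  by (subst card_Diff_subset) (auto simp: nonzero_squares_def)

lemma sum_qchar: "(\<Sum>x\<in>carrier R. qchar x) = 0"
proof -
  have "(\<Sum>x\<in>carrier R. qchar x) = (\<Sum>x\<in>nonzero_squares \<union> (carrier R - {\<zero>} - nonzero_squares). qchar x)"
    using finite_carrier by (intro sum.mono_neutral_right) (auto simp: nonzero_squares_def qchar_def)
  also have "\<dots> = (\<Sum>x\<in>nonzero_squares. qchar x) + (\<Sum>x\<in>carrier R - {\<zero>} - nonzero_squares. qchar x)"
    using finite_carrier finite_nonzero_squares by (intro sum.union_disjoint) auto
  also have "(\<Sum>x\<in>nonzero_squares. qchar x) = (\<Sum>x\<in>nonzero_squares. 1)"
    by (intro sum.cong) (auto simp: qchar_def nonzero_squares_def)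
  also have "(\<Sum>x\<in>carrier R - {\<zero>} - nonzero_squares. qchar x) = (\<Sum>x\<in>carrier R - {\<zero>} - nonzero_squares. -1)"
    by (intro sum.cong) (auto simp: qchar_def)
  also have "(\<Sum>x\<in>nonzero_squares. 1) + (\<Sum>x\<in>carrier R - {\<zero>} - nonzero_squares. -1) = (0::real)"
    by (simp add: card_nonsquares)
  finally show ?thesis .
qed

text \<open>Multiplication by a nonsquare maps the nonzero squares injectively into the equally many
  nonsquares, hence onto them, so it maps nonsquares to squares.\<close>

lemma qchar_mult:
  assumes x: "x \<in> carrier R" and z: "z \<in> carrier R"
  shows "qchar (x \<otimes> z) = qchar x * qchar z"
proof -
  consider "x = \<zero> \<or> z = \<zero>" | "x \<in> nonzero_squares" | "z \<in> nonzero_squares"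
    | "x \<noteq> \<zero>" "z \<noteq> \<zero>" "x \<notin> nonzero_squares" "z \<notin> nonzero_squares" by blast
  thus ?thesis
  proof cases
    case 1 thus ?thesis using x z by (auto simp: qchar_def)
  next
    case 2
    hence "qchar x = 1" by (auto simp: qchar_def nonzero_squares_def)
    thus ?thesis using qchar_mult_square[OF 2 z] by simp
  next
    case 3
    hence "qchar z = 1" by (auto simp: qchar_def nonzero_squares_def)
    thus ?thesis using qchar_mult_square[OF 3 x] x z by (simp add: m_comm)
  next
    case 4
    let ?N = "carrier R - {\<zero>} - nonzero_squares"
    have "(\<otimes>) x ` nonzero_squares \<subseteq> ?N"
    proof
      fix w assume "w \<in> (\<otimes>) x ` nonzero_squares"
      then obtain s where s: "s \<in> nonzero_squares" "w = x \<otimes> s" by blast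
      have sR: "s \<in> carrier R" "s \<noteq> \<zero>" using s by (auto simp: nonzero_squares_def)
      have "qchar w = -1" using qchar_mult_square[OF s(1) x] s sR x 4 by (simp add: m_comm qchar_def)
      thus "w \<in> ?N" using s sR x by (auto simp: qchar_def split: if_splits)
    qed
    moreover have "inj_on ((\<otimes>) x) nonzero_squares"
      using x 4 by (intro inj_onI) (auto simp: nonzero_squares_def m_lcancel)
    hence "card ((\<otimes>) x ` nonzero_squares) = card ?N"
      by (simp add: card_image card_nonsquares)
    ultimately have img: "(\<otimes>) x ` nonzero_squares = ?N"
      using finite_carrier by (intro card_subset_eq) auto
    have "x \<otimes> z \<in> nonzero_squares"
    proof (rule ccontr)
      assume "x \<otimes> z \<notin> nonzero_squares"
      hence "x \<otimes> z \<in> ?N" using x z 4 by (auto simp: integral_iff)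
      then obtain s where "s \<in> nonzero_squares" "x \<otimes> z = x \<otimes> s" unfolding img[symmetric] by blast
      hence "z = s" using x z 4 m_lcancel[of x z s] by (auto simp: nonzero_squares_def)
      thus False using \<open>s \<in> nonzero_squares\<close> 4 by simp
    qed
    thus ?thesis using x z 4 by (auto simp: qchar_def integral_iff)
  qed
qed

lemma qchar_inv:
  assumes "x \<in> carrier R" "x \<noteq> \<zero>"
  shows "qchar (inv x) = qchar x"
proof -
  have "qchar x * qchar (inv x) = 1"
    using qchar_mult[of x "inv x"] assms one_nonzero_square by (simp add: qchar_def)
  thus ?thesis by (auto simp: qchar_def split: if_splits)
qed

text \<open>The quotient of the two linear forms is a Moebius transformation of \<open>c\<close>: it is injective,
  and misses at most one value, where the full character sum vanishes.\<close>

lemma qchar_sum_two_linear: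
  assumes ab: "a \<in> carrier R" "b \<in> carrier R" and r: "r \<in> carrier R" "r \<noteq> \<zero>" and neq: "a \<noteq> b"
  shows "\<bar>\<Sum>c\<in>carrier R. qchar (a \<otimes> c \<oplus> r) * qchar (b \<otimes> c \<oplus> r)\<bar> \<le> 1"
proof -
  define S where "S = {c \<in> carrier R. b \<otimes> c \<oplus> r \<noteq> \<zero>}"
  define f where "f = (\<lambda>c. (a \<otimes> c \<oplus> r) \<otimes> inv (b \<otimes> c \<oplus> r))"
  have fin: "finite S" using finite_carrier by (simp add: S_def)
  have fS: "f ` S \<subseteq> carrier R" using ab r by (auto simp: f_def S_def)
  have inj: "inj_on f S"
  proof (rule inj_onI)
    fix c d assume cd: "c \<in> S" "d \<in> S" and eq: "f c = f d"
    define u w where "u = b \<otimes> c \<oplus> r" and "w = b \<otimes> d \<oplus> r"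
    have C: "c \<in> carrier R" "d \<in> carrier R" "u \<noteq> \<zero>" "w \<noteq> \<zero>" using cd by (auto simp: S_def u_def w_def)
    have uw: "u \<in> carrier R" "w \<in> carrier R" using C ab r by (auto simp: u_def w_def)
    have "(a \<otimes> c \<oplus> r) \<otimes> inv u = (a \<otimes> d \<oplus> r) \<otimes> inv w" using eq by (simp add: f_def u_def w_def)
    hence "((a \<otimes> c \<oplus> r) \<otimes> inv u) \<otimes> (u \<otimes> w) = ((a \<otimes> d \<oplus> r) \<otimes> inv w) \<otimes> (u \<otimes> w)" by simp
    moreover have "((a \<otimes> c \<oplus> r) \<otimes> inv u) \<otimes> (u \<otimes> w) = (a \<otimes> c \<oplus> r) \<otimes> (inv u \<otimes> u) \<otimes> w"
      using C uw ab r by (simp add: m_assoc del: l_inv r_inv)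
    moreover have "((a \<otimes> d \<oplus> r) \<otimes> inv w) \<otimes> (u \<otimes> w) = (a \<otimes> d \<oplus> r) \<otimes> (inv w \<otimes> w) \<otimes> u"
      using C uw ab r by (simp add: m_ac del: l_inv r_inv)
    ultimately have "(a \<otimes> c \<oplus> r) \<otimes> w = (a \<otimes> d \<oplus> r) \<otimes> u" using C uw ab r by simp
    hence "(a \<otimes> c \<oplus> r) \<otimes> w \<ominus> (a \<otimes> d \<oplus> r) \<otimes> u = \<zero>"
      using C uw ab r eq_diff0 by simp
    \<comment> \<open>The factor \<open>r \<otimes> (a \<ominus> b)\<close> is the determinant of
      the Moebius transformation; it is nonzero because \<open>r \<noteq> \<zero>\<close> and
      \<open>a \<noteq> b\<close>.\<close>
    moreover have "(a \<otimes> c \<oplus> r) \<otimes> w \<ominus> (a \<otimes> d \<oplus> r) \<otimes> u = r \<otimes> ((a \<ominus> b) \<otimes> (c \<ominus> d))"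
      unfolding u_def w_def using C(1,2) ab r(1) by algebra
    ultimately show "c = d" using r ab neq C by (simp add: integral_iff eq_diff0)
  qed
  have "(\<Sum>c\<in>carrier R. qchar (a \<otimes> c \<oplus> r) * qchar (b \<otimes> c \<oplus> r)) = (\<Sum>c\<in>S. qchar (f c))"
  proof (rule sum.mono_neutral_cong_right[OF finite_carrier])
    show "S \<subseteq> carrier R" by (auto simp: S_def)
    show "\<forall>c\<in>carrier R - S. qchar (a \<otimes> c \<oplus> r) * qchar (b \<otimes> c \<oplus> r) = 0"
      by (auto simp: S_def qchar_def)
    fix c assume "c \<in> S"
    thus "qchar (a \<otimes> c \<oplus> r) * qchar (b \<otimes> c \<oplus> r) = qchar (f c)"
      using ab r by (auto simp: S_def f_def qchar_mult qchar_inv)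
  qed
  also have "\<dots> = (\<Sum>x\<in>f ` S. qchar x)" using inj by (simp add: sum.reindex)
  also have "\<dots> = - (\<Sum>x\<in>carrier R - f ` S. qchar x)"
    using sum.subset_diff[OF fS finite_carrier, of qchar] sum_qchar by simp
  also have "\<bar>\<dots>\<bar> \<le> (\<Sum>x\<in>carrier R - f ` S. 1)"
    unfolding abs_minus_cancel by (rule order_trans[OF sum_abs sum_mono]) (simp add: abs_qchar_le_1)
  also have "\<dots> = real (card (carrier R) - card S)"
    using fS fin inj by (simp add: card_Diff_subset card_image)
  also have "card (carrier R) - card S = card (carrier R - S)"
    using fin by (subst card_Diff_subset) (auto simp: S_def)
  also have "carrier R - S = {c \<in> carrier R. b \<otimes> c \<oplus> r = \<zero>}" by (auto simp: S_def)
  also have "real (card \<dots>) \<le> 1" using card_root_le_1[OF ab(2) r] by simp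
  finally show ?thesis by simp
qed

lemma qchar_sum_two_linear_le:
  assumes "a \<in> carrier R" "b \<in> carrier R" "r \<in> carrier R" "r \<noteq> \<zero>"
  shows "\<bar>\<Sum>c\<in>carrier R. qchar (a \<otimes> c \<oplus> r) * qchar (b \<otimes> c \<oplus> r)\<bar>
    \<le> 1 + (if a = b then real (card (carrier R)) else 0)"
proof (cases "a = b")
  case True
  have "\<bar>\<Sum>c\<in>carrier R. qchar (a \<otimes> c \<oplus> r) * qchar (b \<otimes> c \<oplus> r)\<bar> \<le> (\<Sum>c\<in>carrier R. 1)"
    by (rule order_trans[OF sum_abs sum_mono]) (simp add: abs_mult mult_le_one abs_qchar_le_1)
  then show ?thesis using True by simp
qed (use qchar_sum_two_linear[OF assms] in auto)

text \<open>This is the sum over two linear forms with \<open>b = \<zero>\<close>: the second factor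
  is the constant \<open>qchar r\<close>, of absolute value 1, and the exceptional case
  \<open>a = b\<close> becomes \<open>a = \<zero>\<close>.\<close>

lemma qchar_sum_linear_le:
  assumes "a \<in> carrier R" "r \<in> carrier R" "r \<noteq> \<zero>"
  shows "\<bar>\<Sum>c\<in>carrier R. qchar (a \<otimes> c \<oplus> r)\<bar> \<le> 1 + (if a = \<zero> then real (card (carrier R)) else 0)"
proof -
  have "\<bar>\<Sum>c\<in>carrier R. qchar (a \<otimes> c \<oplus> r) * qchar (\<zero> \<otimes> c \<oplus> r)\<bar> = \<bar>\<Sum>c\<in>carrier R. qchar (a \<otimes> c \<oplus> r) * qchar r\<bar>"
    using assms by (intro arg_cong[of _ _ abs] sum.cong) auto
  also have "\<dots> = \<bar>\<Sum>c\<in>carrier R. qchar (a \<otimes> c \<oplus> r)\<bar> * \<bar>qchar r\<bar>"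
    by (simp add: sum_distrib_right[symmetric] abs_mult)
  also have "\<bar>qchar r\<bar> = 1" using assms by (simp add: qchar_def)
  finally show ?thesis using qchar_sum_two_linear_le[of a \<zero> r] assms by simp
qed

section \<open>Counting triples over finite fields\<close>

definition tsum :: "('a \<Rightarrow> 'a \<Rightarrow> 'a \<Rightarrow> real) \<Rightarrow> real" where
  "tsum f = (\<Sum>a\<in>carrier R. \<Sum>b\<in>carrier R. \<Sum>c\<in>carrier R. f a b c)"

lemma tsum_swap12: "tsum f = tsum (\<lambda>a b c. f b a c)"
  unfolding tsum_def by (rule sum.swap)

lemma tsum_swap23: "tsum f = tsum (\<lambda>a b c. f a c b)"
  unfolding tsum_def by (intro sum.cong refl sum.swap)

lemma tsum_cong:
  "(\<And>a b c. a \<in> carrier R \<Longrightarrow> b \<in> carrier R \<Longrightarrow> c \<in> carrier R \<Longrightarrow> f a b c = g a b c) \<Longrightarrow> tsum f = tsum g"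
  unfolding tsum_def by (intro sum.cong) auto

lemma tsum_add: "tsum (\<lambda>a b c. f a b c + g a b c) = tsum f + tsum g"
  by (simp add: tsum_def sum.distrib)

lemma tsum_abs_le:
  assumes "\<And>a b c. a \<in> carrier R \<Longrightarrow> b \<in> carrier R \<Longrightarrow> c \<in> carrier R \<Longrightarrow> \<bar>f a b c\<bar> \<le> g a b c"
  shows "\<bar>tsum f\<bar> \<le> tsum g"
  unfolding tsum_def
  by (intro order_trans[OF sum_abs] sum_mono order_refl assms)
     (auto intro!: order_trans[OF sum_abs] sum_mono assms)

lemma card_triples:
  "real (card {(a, b, c). a \<in> carrier R \<and> b \<in> carrier R \<and> c \<in> carrier R \<and> P a b c}) =
     tsum (\<lambda>a b c. of_bool (P a b c))"
proof -
  have "tsum (\<lambda>a b c. of_bool (P a b c)) =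
    (\<Sum>(a, b, c)\<in>carrier R \<times> carrier R \<times> carrier R. of_bool (P a b c))"
    by (simp add: tsum_def sum.cartesian_product)
  also have "\<dots> = (\<Sum>x\<in>{(a, b, c). a \<in> carrier R \<and> b \<in> carrier R \<and> c \<in> carrier R \<and> P a b c}. 1)"
    by (rule sum.mono_neutral_cong_right) (use finite_carrier in auto)
  finally show ?thesis by simp
qed

text \<open>The constant 1 adds up to q^2 over all pairs, with q the size of the field;
  \<open>h\<close> collects the excess at exceptional pairs, where the inner sum need not
  cancel.\<close>

lemma tsum_bound:
  assumes "\<And>a b. a \<in> carrier R \<Longrightarrow> b \<in> carrier R \<Longrightarrow> \<bar>\<Sum>c\<in>carrier R. f a b c\<bar> \<le> 1 + h a b"
    and "(\<Sum>a\<in>carrier R. \<Sum>b\<in>carrier R. h a b) \<le> B"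
  shows "\<bar>tsum f\<bar> \<le> real (card (carrier R)) ^ 2 + B"
proof -
  have "\<bar>tsum f\<bar> \<le> (\<Sum>a\<in>carrier R. \<Sum>b\<in>carrier R. 1 + h a b)"
    unfolding tsum_def
    by (intro order_trans[OF sum_abs] sum_mono order_refl assms(1))
       (auto intro!: order_trans[OF sum_abs] sum_mono assms(1))
  also have "\<dots> = real (card (carrier R)) ^ 2 + (\<Sum>a\<in>carrier R. \<Sum>b\<in>carrier R. h a b)"
    by (simp add: sum.distrib numeral_2_eq_2)
  finally show ?thesis using assms(2) by simp
qed

context
  fixes r assumes r: "r \<in> carrier R" "r \<noteq> \<zero>"
begin

text \<open>The exceptional pairs are those with \<open>a = \<zero>\<close>: there are q of them,
  each costing q. The other two sums follow by permuting variables.\<close>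

lemma tsum_qchar_le:
  "\<bar>tsum (\<lambda>a b c. qchar (a \<otimes> c \<oplus> r))\<bar> \<le> 2 * real (card (carrier R)) ^ 2"
  "\<bar>tsum (\<lambda>a b c. qchar (b \<otimes> c \<oplus> r))\<bar> \<le> 2 * real (card (carrier R)) ^ 2"
  "\<bar>tsum (\<lambda>a b c. qchar (a \<otimes> b \<oplus> r))\<bar> \<le> 2 * real (card (carrier R)) ^ 2"
proof -
  have "(\<Sum>a\<in>carrier R. \<Sum>b\<in>carrier R. if a = \<zero> then real (card (carrier R)) else 0) = real (card (carrier R)) ^ 2"
    using finite_carrier by (subst sum.swap) (simp add: numeral_2_eq_2)
  thus 1: "\<bar>tsum (\<lambda>a b c. qchar (a \<otimes> c \<oplus> r))\<bar> \<le> 2 * real (card (carrier R)) ^ 2"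
    using tsum_bound[where f = "\<lambda>a b c. qchar (a \<otimes> c \<oplus> r)"
        and h = "\<lambda>a b. if a = \<zero> then real (card (carrier R)) else 0" and B = "real (card (carrier R)) ^ 2"]
      qchar_sum_linear_le[OF _ r] by fastforce
  show "\<bar>tsum (\<lambda>a b c. qchar (b \<otimes> c \<oplus> r))\<bar> \<le> 2 * real (card (carrier R)) ^ 2"
    using 1 by (subst tsum_swap12)
  show "\<bar>tsum (\<lambda>a b c. qchar (a \<otimes> b \<oplus> r))\<bar> \<le> 2 * real (card (carrier R)) ^ 2"
    using 1 by (subst tsum_swap23)
qed

lemma sum_diagonal:
  "(\<Sum>a\<in>carrier R. \<Sum>b\<in>carrier R. if a = b then real (card (carrier R)) else 0) \<le> real (card (carrier R)) ^ 2"
  using finite_carrier by (simp add: numeral_2_eq_2)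

text \<open>The exceptional pairs form the diagonal, again q pairs costing q each. In the triple
  product \<open>qchar (a \<otimes> b \<oplus> r)\<close> does not depend on \<open>c\<close> and
  leaves the inner sum.\<close>

lemma tsum_qchar_two_le:
  "\<bar>tsum (\<lambda>a b c. qchar (a \<otimes> c \<oplus> r) * qchar (b \<otimes> c \<oplus> r))\<bar> \<le> 2 * real (card (carrier R)) ^ 2"
  "\<bar>tsum (\<lambda>a b c. qchar (a \<otimes> b \<oplus> r) * qchar (b \<otimes> c \<oplus> r))\<bar> \<le> 2 * real (card (carrier R)) ^ 2"
  "\<bar>tsum (\<lambda>a b c. qchar (a \<otimes> b \<oplus> r) * qchar (a \<otimes> c \<oplus> r))\<bar> \<le> 2 * real (card (carrier R)) ^ 2"
  "\<bar>tsum (\<lambda>a b c. qchar (a \<otimes> b \<oplus> r) * (qchar (a \<otimes> c \<oplus> r) * qchar (b \<otimes> c \<oplus> r)))\<bar> \<le> 2 * real (card (carrier R)) ^ 2"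
proof -
  let ?h = "\<lambda>a b. if a = b then real (card (carrier R)) else 0"
  show 1: "\<bar>tsum (\<lambda>a b c. qchar (a \<otimes> c \<oplus> r) * qchar (b \<otimes> c \<oplus> r))\<bar> \<le> 2 * real (card (carrier R)) ^ 2"
    using tsum_bound[where f = "\<lambda>a b c. qchar (a \<otimes> c \<oplus> r) * qchar (b \<otimes> c \<oplus> r)" and h = ?h]
      qchar_sum_two_linear_le[OF _ _ r] sum_diagonal by fastforce
  have "tsum (\<lambda>a b c. qchar (a \<otimes> b \<oplus> r) * qchar (b \<otimes> c \<oplus> r)) =
      tsum (\<lambda>a b c. qchar (a \<otimes> c \<oplus> r) * qchar (b \<otimes> c \<oplus> r))"
    by (subst tsum_swap23, rule tsum_cong) (simp add: m_comm)
  thus "\<bar>tsum (\<lambda>a b c. qchar (a \<otimes> b \<oplus> r) * qchar (b \<otimes> c \<oplus> r))\<bar> \<le> 2 * real (card (carrier R)) ^ 2"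
    using 1 by simp
  have "tsum (\<lambda>a b c. qchar (a \<otimes> b \<oplus> r) * qchar (a \<otimes> c \<oplus> r)) =
      tsum (\<lambda>a b c. qchar (a \<otimes> c \<oplus> r) * qchar (b \<otimes> c \<oplus> r))"
    by (subst tsum_swap12, subst tsum_swap23, rule tsum_cong) (simp add: m_comm)
  thus "\<bar>tsum (\<lambda>a b c. qchar (a \<otimes> b \<oplus> r) * qchar (a \<otimes> c \<oplus> r))\<bar> \<le> 2 * real (card (carrier R)) ^ 2"
    using 1 by simp
  have "\<bar>\<Sum>c\<in>carrier R. qchar (a \<otimes> b \<oplus> r) * (qchar (a \<otimes> c \<oplus> r) * qchar (b \<otimes> c \<oplus> r))\<bar> \<le> 1 + ?h a b"
    if ab: "a \<in> carrier R" "b \<in> carrier R" for a b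
  proof -
    have "\<bar>\<Sum>c\<in>carrier R. qchar (a \<otimes> b \<oplus> r) * (qchar (a \<otimes> c \<oplus> r) * qchar (b \<otimes> c \<oplus> r))\<bar> =
      \<bar>qchar (a \<otimes> b \<oplus> r)\<bar> * \<bar>\<Sum>c\<in>carrier R. qchar (a \<otimes> c \<oplus> r) * qchar (b \<otimes> c \<oplus> r)\<bar>"
      by (simp add: sum_distrib_left[symmetric] abs_mult)
    also have "\<dots> \<le> 1 * \<bar>\<Sum>c\<in>carrier R. qchar (a \<otimes> c \<oplus> r) * qchar (b \<otimes> c \<oplus> r)\<bar>"
      by (intro mult_right_mono abs_qchar_le_1) simp
    finally show ?thesis using qchar_sum_two_linear_le[OF ab r] by simp
  qed
  thus "\<bar>tsum (\<lambda>a b c. qchar (a \<otimes> b \<oplus> r) * (qchar (a \<otimes> c \<oplus> r) * qchar (b \<otimes> c \<oplus> r)))\<bar> \<le> 2 * real (card (carrier R)) ^ 2"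
    using tsum_bound[OF _ sum_diagonal, where f = "\<lambda>a b c. qchar (a \<otimes> b \<oplus> r) * (qchar (a \<otimes> c \<oplus> r) * qchar (b \<otimes> c \<oplus> r))"]
    by fastforce
qed

text \<open>For each of the q^2 choices of the remaining variables, a form vanishes for at most one
  value of the variable in which it is linear.\<close>

lemma tsum_zero_le:
  "tsum (\<lambda>a b c. of_bool (a \<otimes> b \<oplus> r = \<zero>) + of_bool (b \<otimes> c \<oplus> r = \<zero>) + of_bool (a \<otimes> c \<oplus> r = \<zero>))
    \<le> 3 * real (card (carrier R)) ^ 2"
proof -
  have "\<bar>tsum (\<lambda>a b c. of_bool (a \<otimes> c \<oplus> r = \<zero>))\<bar> \<le> real (card (carrier R)) ^ 2 + 0"
  proof (rule tsum_bound[where h = "\<lambda>_ _. 0"])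
    fix a b assume "a \<in> carrier R" "b \<in> carrier R"
    have "(\<Sum>c\<in>carrier R. of_bool (a \<otimes> c \<oplus> r = \<zero>)) = real (card {c \<in> carrier R. a \<otimes> c \<oplus> r = \<zero>})"
      using finite_carrier by (simp add: of_bool_def sum.If_cases Int_def)
    thus "\<bar>\<Sum>c\<in>carrier R. of_bool (a \<otimes> c \<oplus> r = \<zero>)\<bar> \<le> 1 + (0::real)"
      using card_root_le_1[OF \<open>a \<in> carrier R\<close> r] by simp
  qed simp
  moreover have "tsum (\<lambda>a b c. of_bool (a \<otimes> b \<oplus> r = \<zero>)) = tsum (\<lambda>a b c. of_bool (a \<otimes> c \<oplus> r = \<zero>))"
    by (subst tsum_swap23) simp
  moreover have "tsum (\<lambda>a b c. of_bool (b \<otimes> c \<oplus> r = \<zero>)) = tsum (\<lambda>a b c. of_bool (a \<otimes> c \<oplus> r = \<zero>))"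
    by (subst tsum_swap12) simp
  ultimately show ?thesis by (simp add: tsum_add)
qed

lemma card_zero_triples_le:
  "real (card {(a, b, c). a \<in> carrier R \<and> b \<in> carrier R \<and> c \<in> carrier R \<and>
      (a \<otimes> b \<oplus> r = \<zero> \<or> b \<otimes> c \<oplus> r = \<zero> \<or> a \<otimes> c \<oplus> r = \<zero>)}) \<le> 3 * real (card (carrier R)) ^ 2"
proof -
  have "tsum (\<lambda>a b c. of_bool (a \<otimes> b \<oplus> r = \<zero> \<or> b \<otimes> c \<oplus> r = \<zero> \<or> a \<otimes> c \<oplus> r = \<zero>)) \<le>
    tsum (\<lambda>a b c. of_bool (a \<otimes> b \<oplus> r = \<zero>) + of_bool (b \<otimes> c \<oplus> r = \<zero>) + of_bool (a \<otimes> c \<oplus> r = \<zero>))"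
    unfolding tsum_def by (intro sum_mono) auto
  thus ?thesis using tsum_zero_le by (subst card_triples) linarith
qed

text \<open>Where no form vanishes, the product of the three factors \<open>1 + qchar\<close> is
  exactly 8 times the indicator. Expanding it gives q^3 and seven character sums, each at most 2
  q^2; with 12 q^2 for the defect \<open>E\<close> this makes 26 = 12 + 7 * 2.\<close>

lemma card_square_triples:
  "\<bar>8 * real (card {(a, b, c). a \<in> carrier R \<and> b \<in> carrier R \<and> c \<in> carrier R \<and>
      a \<otimes> b \<oplus> r \<in> nonzero_squares \<and> b \<otimes> c \<oplus> r \<in> nonzero_squares \<and> a \<otimes> c \<oplus> r \<in> nonzero_squares})
    - real (card (carrier R)) ^ 3\<bar> \<le> 26 * real (card (carrier R)) ^ 2"
proof -
  let ?q = "real (card (carrier R))"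
  define X Y W where "X = (\<lambda>a b (c::'a). qchar (a \<otimes> b \<oplus> r))" and "Y = (\<lambda>(a::'a) b c. qchar (b \<otimes> c \<oplus> r))"
    and "W = (\<lambda>a (b::'a) c. qchar (a \<otimes> c \<oplus> r))"
  define I where "I = (\<lambda>a b c. of_bool (a \<otimes> b \<oplus> r \<in> nonzero_squares \<and> b \<otimes> c \<oplus> r \<in> nonzero_squares
    \<and> a \<otimes> c \<oplus> r \<in> nonzero_squares) :: real)"
  define E where "E = (\<lambda>a b c. 8 * I a b c - (1 + X a b c) * (1 + Y a b c) * (1 + W a b c))"
  have qc: "qchar x = 0 \<or> qchar x = 1 \<or> qchar x = -1" "qchar x = 0 \<longleftrightarrow> x = \<zero>" "qchar x = 1 \<longleftrightarrow> x \<in> nonzero_squares" for x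
    by (auto simp: qchar_def nonzero_squares_def)
  \<comment> \<open>If some form vanishes, the indicator is 0 and the product is at most 1 * 2 * 2 =
    4; otherwise \<open>E\<close> is 0.\<close>
  have "\<bar>E a b c\<bar> \<le> 4 * (of_bool (a \<otimes> b \<oplus> r = \<zero>) + of_bool (b \<otimes> c \<oplus> r = \<zero>) + of_bool (a \<otimes> c \<oplus> r = \<zero>))" for a b c
    unfolding E_def I_def X_def Y_def W_def qc(2)[symmetric] qc(3)[symmetric]
    using qc(1)[of "a \<otimes> b \<oplus> r"] qc(1)[of "b \<otimes> c \<oplus> r"] qc(1)[of "a \<otimes> c \<oplus> r"]
    by (elim disjE) simp_all
  hence "\<bar>tsum E\<bar> \<le> tsum (\<lambda>a b c. 4 * (of_bool (a \<otimes> b \<oplus> r = \<zero>) + of_bool (b \<otimes> c \<oplus> r = \<zero>) + of_bool (a \<otimes> c \<oplus> r = \<zero>)))"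
    by (intro tsum_abs_le)
  also have "\<dots> = 4 * tsum (\<lambda>a b c. of_bool (a \<otimes> b \<oplus> r = \<zero>) + of_bool (b \<otimes> c \<oplus> r = \<zero>) + of_bool (a \<otimes> c \<oplus> r = \<zero>))"
    by (simp add: tsum_def sum_distrib_left)
  finally have E: "\<bar>tsum E\<bar> \<le> 12 * ?q ^ 2" using tsum_zero_le by linarith
  have "8 * tsum I = tsum (\<lambda>a b c. 8 * I a b c)" by (simp add: tsum_def sum_distrib_left)
  also have "(\<lambda>a b c. 8 * I a b c) = (\<lambda>a b c. E a b c + (1 + (X a b c + (Y a b c + (W a b c +
      (X a b c * Y a b c + (X a b c * W a b c + (W a b c * Y a b c + X a b c * (W a b c * Y a b c)))))))))"
    by (simp add: E_def algebra_simps fun_eq_iff)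
  also have "tsum \<dots> = tsum E + (?q ^ 3 + (tsum X + (tsum Y + (tsum W + (tsum (\<lambda>a b c. X a b c * Y a b c)
      + (tsum (\<lambda>a b c. X a b c * W a b c) + (tsum (\<lambda>a b c. W a b c * Y a b c) + tsum (\<lambda>a b c. X a b c * (W a b c * Y a b c)))))))))"
    unfolding tsum_add by (simp add: tsum_def power3_eq_cube)
  finally have "\<bar>8 * tsum I - ?q ^ 3\<bar> \<le> \<bar>tsum E\<bar> + \<bar>tsum X\<bar> + \<bar>tsum Y\<bar> + \<bar>tsum W\<bar>
      + \<bar>tsum (\<lambda>a b c. X a b c * Y a b c)\<bar> + \<bar>tsum (\<lambda>a b c. X a b c * W a b c)\<bar>
      + \<bar>tsum (\<lambda>a b c. W a b c * Y a b c)\<bar> + \<bar>tsum (\<lambda>a b c. X a b c * (W a b c * Y a b c))\<bar>"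
    by linarith
  also have "\<dots> \<le> 12 * ?q ^ 2 + 2 * ?q ^ 2 + 2 * ?q ^ 2 + 2 * ?q ^ 2 + 2 * ?q ^ 2 + 2 * ?q ^ 2 + 2 * ?q ^ 2 + 2 * ?q ^ 2"
    unfolding X_def Y_def W_def by (intro add_mono E tsum_qchar_le tsum_qchar_two_le)
  finally have "\<bar>8 * tsum I - ?q ^ 3\<bar> \<le> 26 * ?q ^ 2" by simp
  thus ?thesis by (subst card_triples) (simp add: I_def)
qed

end

end

section \<open>The residue field\<close>

text \<open>This links two renderings of an integer in a ring: the additive power that occurs in
  \<open>diop3\<close>, and \<open>of_integer\<close>, whose arithmetic rules drive the
  simplifications.\<close>

lemma (in ring) add_pow_one: "[n] \<cdot> \<one> = \<guillemotleft>n\<guillemotright>" for n :: int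
proof -
  have nat: "[m] \<cdot> \<one> = \<guillemotleft>m\<guillemotright>\<^sub>\<nat>" for m :: nat
    by (induction m) (simp_all add: a_comm)
  show ?thesis
    using nat by (simp add: add_pow_def int_pow_def2 of_integer_def a_inv_def)
qed

context padic_field
begin

abbreviation "VR \<equiv> valuation_ring K v"

lemma VR_simps [simp]:
  "carrier VR = {x \<in> carrier K. v x \<le> 1}" "x \<otimes>\<^bsub>VR\<^esub> y = x \<otimes> y" "x \<oplus>\<^bsub>VR\<^esub> y = x \<oplus> y"
  "\<one>\<^bsub>VR\<^esub> = \<one>" "\<zero>\<^bsub>VR\<^esub> = \<zero>"
  by (simp_all add: valuation_ring_def)

sublocale VR: cring VR
  rewrites "carrier VR = {x \<in> carrier K. v x \<le> 1}" and "x \<otimes>\<^bsub>VR\<^esub> y = x \<otimes> y" and "x \<oplus>\<^bsub>VR\<^esub> y = x \<oplus> y"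
    and "\<one>\<^bsub>VR\<^esub> = \<one>" and "\<zero>\<^bsub>VR\<^esub> = \<zero>"
proof -
  have "subring {x \<in> carrier K. v x \<le> 1} K"
  proof (rule subringI)
    fix x y assume "x \<in> {x \<in> carrier K. v x \<le> 1}" "y \<in> {x \<in> carrier K. v x \<le> 1}"
    thus "x \<otimes> y \<in> {x \<in> carrier K. v x \<le> 1}" "x \<oplus> y \<in> {x \<in> carrier K. v x \<le> 1}"
      using v_mult_le[of x y 1 1] v_add[of x y] by auto
  qed auto
  thus "cring VR"
    using subcringI' subcring_iff[of "{x \<in> carrier K. v x \<le> 1}"] by (simp add: valuation_ring_def)
qed simp_all

lemma VR_minus [simp]: "x \<in> carrier K \<Longrightarrow> v x \<le> 1 \<Longrightarrow> \<ominus>\<^bsub>VR\<^esub> x = \<ominus> x"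
  by (rule VR.minus_equality) (auto simp: l_neg)

lemma VR_diff [simp]: "x \<in> carrier K \<Longrightarrow> y \<in> carrier K \<Longrightarrow> v y \<le> 1 \<Longrightarrow> x \<ominus>\<^bsub>VR\<^esub> y = x \<ominus> y"
  by (simp add: a_minus_def)

lemma VR_of_int: "[n] \<cdot>\<^bsub>VR\<^esub> \<one>\<^bsub>VR\<^esub> = \<guillemotleft>n\<guillemotright>"
proof -
  have nat: "\<guillemotleft>m\<guillemotright>\<^sub>\<nat>\<^bsub>VR\<^esub> = \<guillemotleft>m\<guillemotright>\<^sub>\<nat>" for m by (induction m) (simp_all add: of_natural_def)
  have "v \<guillemotleft>m\<guillemotright>\<^sub>\<nat> \<le> 1" for m using v_of_int_le_1[of "int m"] by (simp add: of_integer_def)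
  hence "\<guillemotleft>n\<guillemotright>\<^bsub>VR\<^esub> = \<guillemotleft>n\<guillemotright>" by (simp add: of_integer_def nat)
  thus ?thesis using ring.add_pow_one[OF VR.ring_axioms] by simp
qed

lemma squares_VR: "squares VR = {x \<otimes> x |x. x \<in> carrier VR}"
proof -
  have "x [^]\<^bsub>VR\<^esub> (2::nat) = x \<otimes> x" if "x \<in> carrier VR" for x
    using that by (simp add: VR.nat_pow_Suc numeral_2_eq_2)
  thus ?thesis unfolding squares_def by (metis (lifting))
qed

text \<open>The quotient of \<open>y\<close> by \<open>x\<close> is congruent to 1 modulo the
  maximal ideal, hence a square; its root times a root of \<open>x\<close> is a root of
  \<open>y\<close>. This one fact yields both the residue criterion for squares and the openness
  behind measurability.\<close>

lemma square_near_square: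
  assumes p2: "p \<noteq> 2" and x: "x \<in> squares VR" "x \<noteq> \<zero>" and y: "y \<in> carrier K" "v (y \<ominus> x) < v x"
  shows "y \<in> squares VR"
proof -
  obtain s where s: "s \<in> carrier K" "v s \<le> 1" "x = s \<otimes> s" using x by (auto simp: squares_VR)
  have xK: "x \<in> carrier K" using s by simp
  have vx: "v x > 0" using x(2) v_nonneg[OF xK] v_eq_0_iff[OF xK] by simp
  have "y \<otimes> inv x \<ominus> \<one> = (y \<ominus> x) \<otimes> inv x"
    using y(1) xK x(2) by (simp add: minus_eq l_distr l_minus)
  hence "v (y \<otimes> inv x \<ominus> \<one>) = v (y \<ominus> x) * inverse (v x)"
    using y xK x(2) by (simp add: v_mult v_inv)
  also have "\<dots> < 1" using y(2) vx by (simp add: field_simps)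
  finally obtain z where z: "z \<in> carrier K" "z \<otimes> z = y \<otimes> inv x"
    using one_unit_square[OF p2, of "y \<otimes> inv x"] y xK x(2) by auto
  have "y = y \<otimes> inv x \<otimes> x" using y(1) xK x(2) by (simp add: m_assoc)
  also have "\<dots> = (z \<otimes> z) \<otimes> (s \<otimes> s)" by (simp only: z(2) s(3)[symmetric])
  also have "\<dots> = (z \<otimes> s) \<otimes> (z \<otimes> s)" using z(1) s(1) by (simp add: m_ac)
  finally have eq: "y = (z \<otimes> s) \<otimes> (z \<otimes> s)" .
  have "y = x \<oplus> (y \<ominus> x)" using y(1) xK by algebra
  hence "v y \<le> 1"
    using v_add[of x "y \<ominus> x"] y xK s v_mult_le[of s s 1 1] by (metis dual_order.strict_trans1 less_imp_le max_def minus_closed mult_1 order_trans)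
  hence "v (z \<otimes> s) * v (z \<otimes> s) \<le> 1 * 1" using eq z s by (metis m_closed mult_1 v_mult)
  hence "v (z \<otimes> s) \<le> 1" using mult_strict_mono[of 1 "v (z \<otimes> s)" 1 "v (z \<otimes> s)"] by force
  thus ?thesis using eq z s by (auto simp: squares_VR)
qed

definition max_ideal :: "'a set" where
  "max_ideal = {x \<in> carrier K. v x < 1}"

lemma ideal_max_ideal: "ideal max_ideal VR"
proof (rule idealI[OF VR.ring_axioms])
  show "subgroup max_ideal (add_monoid VR)"
  proof (rule group.subgroupI[OF abelian_group.a_group[OF VR.abelian_group_axioms]])
    show "max_ideal \<subseteq> carrier (add_monoid VR)" by (auto simp: max_ideal_def)
    show "max_ideal \<noteq> {}" by (auto simp: max_ideal_def intro!: exI[of _ \<zero>])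
    fix x assume x: "x \<in> max_ideal"
    hence "\<ominus>\<^bsub>VR\<^esub> x \<in> max_ideal" by (simp add: max_ideal_def)
    thus "inv\<^bsub>add_monoid VR\<^esub> x \<in> max_ideal" by (simp only: a_inv_def)
    fix y assume "y \<in> max_ideal"
    thus "x \<otimes>\<^bsub>add_monoid VR\<^esub> y \<in> max_ideal"
      using x v_add[of x y] by (auto simp: max_ideal_def)
  qed
next
  fix a x assume ax: "a \<in> max_ideal" "x \<in> carrier VR"
  hence "v (x \<otimes> a) \<le> 1 * v a" by (intro v_mult_le) (auto simp: max_ideal_def)
  thus "x \<otimes>\<^bsub>VR\<^esub> a \<in> max_ideal" "a \<otimes>\<^bsub>VR\<^esub> x \<in> max_ideal"
    using ax m_comm[of a x] by (auto simp: max_ideal_def)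
qed

text \<open>An integral element with \<open>v x = 1\<close> has an integral inverse, so an ideal
  that contains one is everything.\<close>

lemma maximalideal_max_ideal: "maximalideal max_ideal VR"
proof (rule maximalidealI[OF ideal_max_ideal])
  show "carrier VR \<noteq> max_ideal" by (auto simp: max_ideal_def set_eq_iff intro!: exI[of _ \<one>])
  fix J assume J: "ideal J VR" "max_ideal \<subseteq> J" "J \<subseteq> carrier VR"
  show "J = max_ideal \<or> J = carrier VR"
  proof (rule disjCI)
    assume "J \<noteq> carrier VR"
    have "v x < 1" if x: "x \<in> J" for x
    proof (rule ccontr)
      assume "\<not> v x < 1"
      hence x1: "x \<in> carrier K" "v x = 1" using x J by auto
      have x0: "x \<noteq> \<zero>" using x1 by auto
      have "inv x \<otimes>\<^bsub>VR\<^esub> x \<in> J" using ideal.I_l_closed[OF J(1) x, of "inv x"] x1 x0 by (simp add: v_inv)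
      hence "\<one>\<^bsub>VR\<^esub> \<in> J" using x1 x0 by simp
      hence "J = carrier VR" by (rule ideal.one_imp_carrier[OF J(1)])
      thus False using \<open>J \<noteq> carrier VR\<close> by simp
    qed
    thus "J = max_ideal" using J by (auto simp: max_ideal_def)
  qed
qed

section \<open>Reduction to the residue field\<close>

definition res_field where "res_field = VR Quot max_ideal"

definition res :: "'a \<Rightarrow> 'a set" where "res x = max_ideal +>\<^bsub>VR\<^esub> x"

lemma res_hom: "res \<in> ring_hom VR res_field"
  using ideal.rcos_ring_hom[OF ideal_max_ideal] by (simp add: res_field_def res_def[abs_def])

lemma res_mult: "\<lbrakk>x \<in> carrier VR; y \<in> carrier VR\<rbrakk> \<Longrightarrow> res (x \<otimes> y) = res x \<otimes>\<^bsub>res_field\<^esub> res y"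
  using ring_hom_mult[OF res_hom] by simp

lemma res_add: "\<lbrakk>x \<in> carrier VR; y \<in> carrier VR\<rbrakk> \<Longrightarrow> res (x \<oplus> y) = res x \<oplus>\<^bsub>res_field\<^esub> res y"
  using ring_hom_add[OF res_hom] by simp

lemma res_one: "res \<one> = \<one>\<^bsub>res_field\<^esub>"
  using ring_hom_one[OF res_hom] by simp

lemma carrier_res_field: "carrier res_field = res ` carrier VR"
  by (auto simp: res_field_def FactRing_def A_RCOSETS_def' res_def)

lemma res_eq_iff: "\<lbrakk>x \<in> carrier VR; y \<in> carrier VR\<rbrakk> \<Longrightarrow> res x = res y \<longleftrightarrow> v (x \<ominus> y) < 1"
  using VR.quotient_eq_iff_same_a_r_cos[OF ideal_max_ideal, of x y]
  by (auto simp: res_def max_ideal_def)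

lemma res_eq_zero_iff: "x \<in> carrier VR \<Longrightarrow> res x = \<zero>\<^bsub>res_field\<^esub> \<longleftrightarrow> v x < 1"
proof -
  have "res \<zero> = \<zero>\<^bsub>res_field\<^esub>"
    using VR.a_rcos_zero[OF ideal_max_ideal, of \<zero>] by (simp add: res_def res_field_def FactRing_def max_ideal_def)
  moreover assume "x \<in> carrier VR"
  ultimately show ?thesis using res_eq_iff[of x \<zero>] by (simp add: minus_eq)
qed

text \<open>An element of the residue field is literally a coset, a subset of the valuation ring;
  this identity lets it serve both as a field element and as an event for the Haar measure.\<close>

lemma res_as_fibre: "x \<in> carrier VR \<Longrightarrow> res x = {y \<in> carrier VR. res y = res x}"
proof -
  assume x: "x \<in> carrier VR"
  have "y \<in> res x \<longleftrightarrow> y \<in> carrier VR \<and> v (y \<ominus> x) < 1" for y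
  proof
    assume "y \<in> res x"
    then obtain m where m: "m \<in> carrier K" "v m < 1" "y = m \<oplus> x"
      by (auto simp: res_def a_r_coset_def' max_ideal_def)
    moreover have "m = (m \<oplus> x) \<ominus> x" using m x by (simp add: minus_eq a_assoc r_neg)
    ultimately show "y \<in> carrier VR \<and> v (y \<ominus> x) < 1" using x v_add[of m x] by auto
  next
    assume y: "y \<in> carrier VR \<and> v (y \<ominus> x) < 1"
    hence "y = (y \<ominus> x) \<oplus> x" using x by (simp add: minus_eq a_assoc l_neg)
    thus "y \<in> res x" using x y by (auto simp: res_def a_r_coset_def' max_ideal_def)
  qed
  thus ?thesis using res_eq_iff[OF _ x] by auto
qed

text \<open>Points at distance at most 1 / p lie in one residue class, so a finite net of that scale
  meets every class.\<close>

lemma finite_res_field: "finite (carrier res_field)"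
proof -
  obtain T where T: "finite T" "T \<subseteq> carrier K" "\<And>t. t \<in> T \<Longrightarrow> v t \<le> 1"
    "\<And>x. x \<in> carrier K \<Longrightarrow> v x \<le> 1 \<Longrightarrow> \<exists>t\<in>T. v (x \<ominus> t) \<le> 1 / real p"
    by (rule finite_net_Suc_0) blast
  have "carrier res_field \<subseteq> res ` T"
  proof
    fix A assume "A \<in> carrier res_field"
    then obtain x where x: "x \<in> carrier VR" "A = res x" by (auto simp: carrier_res_field)
    then obtain t where t: "t \<in> T" "v (x \<ominus> t) \<le> 1 / real p" using T(4) by auto
    have "v (x \<ominus> t) < 1" using t p_gt_1 by (auto intro: le_less_trans)
    hence "A = res t" using res_eq_iff[of x t] x t T by auto
    thus "A \<in> res ` T" using t by simp
  qed
  thus ?thesis using T(1) finite_surj by blast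
qed

lemma field_res_field: "field res_field"
  unfolding res_field_def using maximalideal.quotient_is_field[OF maximalideal_max_ideal VR.is_cring] .

text \<open>Distinct natural numbers below p have distinct residues. This converts error bounds in 1
  / q, with q the size of the residue field, into bounds in 1 / p.\<close>

lemma card_res_field_ge: "p \<le> card (carrier res_field)"
proof -
  have "inj_on (\<lambda>i. res \<guillemotleft>int i\<guillemotright>) {..<p}"
  proof (rule inj_onI, rule ccontr)
    fix i j assume ij: "i \<in> {..<p}" "j \<in> {..<p}" "res \<guillemotleft>int i\<guillemotright> = res \<guillemotleft>int j\<guillemotright>" "i \<noteq> j"
    have "v \<guillemotleft>int i - int j\<guillemotright> < 1" using ij res_eq_iff[of "\<guillemotleft>int i\<guillemotright>" "\<guillemotleft>int j\<guillemotright>"] v_of_int_le_1 by simp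
    hence "int p dvd int i - int j" using v_of_int_coprime by fastforce
    thus False using ij zdvd_imp_le[of "int p" "\<bar>int i - int j\<bar>"] by auto
  qed
  hence "card {..<p} = card ((\<lambda>i. res \<guillemotleft>int i\<guillemotright>) ` {..<p})" by (simp add: card_image)
  also have "\<dots> \<le> card (carrier res_field)"
    using v_of_int_le_1 by (intro card_mono finite_res_field) (auto simp: carrier_res_field)
  finally show ?thesis by simp
qed

lemma odd_finite_field_res_field:
  assumes "p \<noteq> 2"
  shows "odd_finite_field res_field"
proof -
  have "res \<guillemotleft>2\<guillemotright> = \<one>\<^bsub>res_field\<^esub> \<oplus>\<^bsub>res_field\<^esub> \<one>\<^bsub>res_field\<^esub>"
    using res_add[of \<one> \<one>] by (simp add: of_int_2 res_one)
  moreover have "res \<guillemotleft>2\<guillemotright> \<noteq> \<zero>\<^bsub>res_field\<^esub>" using res_eq_zero_iff[of "\<guillemotleft>2\<guillemotright>"] v_2[OF assms] by simp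
  ultimately show ?thesis
    using field_res_field finite_res_field
    by (intro odd_finite_field.intro odd_finite_field_axioms.intro) simp_all
qed

text \<open>For the lifting direction, \<open>x\<close> and \<open>y \<otimes> y\<close> are units
  with the same residue, so their difference is smaller than \<open>v (y \<otimes> y) = 1\<close>
  and \<open>x\<close> is close to a nonzero square.\<close>

lemma square_iff_res_square:
  assumes p2: "p \<noteq> 2" and x: "x \<in> carrier VR" "res x \<noteq> \<zero>\<^bsub>res_field\<^esub>"
  shows "x \<in> squares VR \<longleftrightarrow> res x \<in> field.nonzero_squares res_field"
proof
  interpret k: field res_field by (rule field_res_field)
  {
    assume "x \<in> squares VR"
    then obtain s where s: "s \<in> carrier VR" "x = s \<otimes> s" by (auto simp: squares_VR)
    hence "res x = res s \<otimes>\<^bsub>res_field\<^esub> res s" using res_mult by simp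
    thus "res x \<in> k.nonzero_squares"
      using x s unfolding k.nonzero_squares_def by (auto simp: carrier_res_field)
  next
    assume "res x \<in> k.nonzero_squares"
    then obtain y where y: "y \<in> carrier VR" "res x = res (y \<otimes> y)"
      unfolding k.nonzero_squares_def by (auto simp: carrier_res_field res_mult)
    have yy: "y \<otimes> y \<in> carrier VR" using y v_mult_le[of y y 1 1] by auto
    have "\<not> v (y \<otimes> y) < 1" using res_eq_zero_iff[OF yy] x y by simp
    hence v1: "v (y \<otimes> y) = 1" using yy by simp
    hence "y \<otimes> y \<noteq> \<zero>" by auto
    moreover have "v (x \<ominus> y \<otimes> y) < v (y \<otimes> y)" using res_eq_iff[OF x(1) yy] y v1 by simp
    moreover have "y \<otimes> y \<in> squares VR" using y by (auto simp: squares_VR)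
    ultimately show "x \<in> squares VR" using square_near_square[OF p2] x by simp
  }
qed

end

section \<open>Haar measure\<close>

text \<open>The condition \<open>p \<noteq> 2\<close> keeps 2 a unit, as the residue criterion for
  squares requires; it holds eventually when the primes tend to infinity.\<close>

locale haar_padic_field = padic_field K p \<phi> v
  for K :: "('a, 'b) ring_scheme" (structure) and p :: nat
    and \<phi> :: "(nat \<Rightarrow> rat) set \<Rightarrow> 'a" and v :: "'a \<Rightarrow> real" +
  fixes \<mu> :: "'a measure"
  assumes haar: "normalized_Haar_measure VR v \<mu>" and odd_p: "p \<noteq> 2"
begin

abbreviation "kf \<equiv> res_field"

sublocale k: odd_finite_field kf
  by (rule odd_finite_field_res_field[OF odd_p])

lemma space_mu: "space \<mu> = carrier VR"
  using haar unfolding normalized_Haar_measure_def by blast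

lemma sets_mu: "valuation_open VR v U \<Longrightarrow> U \<in> sets \<mu>"
  using haar unfolding normalized_Haar_measure_def by blast

lemma translate: "a \<in> carrier VR \<Longrightarrow> S \<in> sets \<mu> \<Longrightarrow> emeasure \<mu> ((\<lambda>x. a \<oplus> x) ` S) = emeasure \<mu> S"
  using haar unfolding normalized_Haar_measure_def by simp

sublocale prob_space \<mu>
  by (rule prob_spaceI) (use haar in \<open>simp add: normalized_Haar_measure_def\<close>)

text \<open>By the ultrametric inequality every point of a ball is a centre of it, so balls are
  open.\<close>

lemma ball_measurable:
  assumes t: "t \<in> carrier VR" and e: "e > 0"
  shows "{y \<in> carrier VR. v (y \<ominus> t) < e} \<in> sets \<mu>"
proof (rule sets_mu, unfold valuation_open_def, intro conjI ballI)
  fix x assume x: "x \<in> {y \<in> carrier VR. v (y \<ominus> t) < e}"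
  have "v (y \<ominus> t) < e" if y: "y \<in> carrier VR" "v (y \<ominus> x) < e" for y
  proof -
    have "y \<in> carrier K" "x \<in> carrier K" "t \<in> carrier K" using x y t by auto
    hence "y \<ominus> t = (y \<ominus> x) \<oplus> (x \<ominus> t)" by algebra
    moreover have "max (v (y \<ominus> x)) (v (x \<ominus> t)) < e" using x y by simp
    ultimately show ?thesis using v_add[of "y \<ominus> x" "x \<ominus> t"] x y t by simp
  qed
  thus "\<exists>e'>0. \<forall>y\<in>carrier VR. v (y \<ominus>\<^bsub>VR\<^esub> x) < e' \<longrightarrow> y \<in> {y \<in> carrier VR. v (y \<ominus> t) < e}"
    using e x by (intro exI[of _ e]) auto
qed auto

lemma res_class_measurable: "A \<in> carrier kf \<Longrightarrow> A \<in> sets \<mu>"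
proof -
  assume "A \<in> carrier kf"
  then obtain x where x: "x \<in> carrier VR" "A = res x" by (auto simp: carrier_res_field)
  have "y \<in> A \<longleftrightarrow> y \<in> carrier VR \<and> v (y \<ominus> x) < 1" for y
    unfolding x(2) using res_as_fibre[OF x(1)] res_eq_iff[OF _ x(1), of y] by blast
  hence "A = {y \<in> carrier VR. v (y \<ominus> x) < 1}" by blast
  thus ?thesis using ball_measurable[OF x(1), of 1] by simp
qed

lemma res_class_subset: "A \<in> carrier kf \<Longrightarrow> A \<subseteq> carrier VR"
  using sets.sets_into_space[OF res_class_measurable] space_mu by blast

lemma mem_res_class_iff: "A \<in> carrier kf \<Longrightarrow> x \<in> A \<longleftrightarrow> x \<in> carrier VR \<and> res x = A"
  using res_as_fibre by (auto simp: carrier_res_field)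

lemma res_class_disjoint:
  assumes "A \<in> carrier kf" "B \<in> carrier kf" "A \<noteq> B"
  shows "A \<inter> B = {}"
proof (rule equals0I)
  fix x assume "x \<in> A \<inter> B"
  hence "res x = A" "res x = B" using mem_res_class_iff assms(1,2) by (metis IntD1, metis IntD2)
  thus False using assms(3) by simp
qed

text \<open>Residue classes are translates of the maximal ideal, so they have equal measure, and
  together they partition a space of measure 1.\<close>

lemma measure_res_class:
  assumes "A \<in> carrier kf"
  shows "measure \<mu> A = 1 / real (card (carrier kf))"
proof -
  have M: "max_ideal = res \<zero>" using VR.a_rcos_zero[OF ideal_max_ideal, of \<zero>] by (simp add: res_def max_ideal_def)
  have eq: "measure \<mu> B = measure \<mu> max_ideal" if B: "B \<in> carrier kf" for B
  proof -
    obtain x where x: "x \<in> carrier VR" "B = res x" using B by (auto simp: carrier_res_field)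
    have "B = (\<lambda>m. x \<oplus> m) ` max_ideal"
      unfolding x(2) res_def a_r_coset_def' using x by (auto simp: max_ideal_def a_comm)
    moreover have "max_ideal \<in> sets \<mu>" unfolding M by (rule res_class_measurable) (auto simp: carrier_res_field)
    ultimately show ?thesis using translate[OF x(1)] by (simp add: measure_def)
  qed
  have "1 = measure \<mu> (\<Union>B\<in>carrier kf. B)"
  proof -
    have "(\<Union>B\<in>carrier kf. B) = space \<mu>"
      unfolding space_mu using res_class_subset res_as_fibre by (fastforce simp: carrier_res_field)
    thus ?thesis using prob_space by simp
  qed
  also have "\<dots> = (\<Sum>B\<in>carrier kf. measure \<mu> B)"
    using finite_res_field res_class_measurable
    by (intro finite_measure_finite_Union) (auto simp: disjoint_family_on_def mem_res_class_iff)
  also have "\<dots> = (\<Sum>B\<in>carrier kf. measure \<mu> max_ideal)" by (intro sum.cong eq refl)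
  finally have "1 = real (card (carrier kf)) * measure \<mu> max_ideal" by simp
  thus ?thesis using eq[OF assms] by (metis mult_zero_left nonzero_mult_div_cancel_left zero_neq_one)
qed

section \<open>Sets of triples determined by residues\<close>

abbreviation "triple_measure \<equiv> \<mu> \<Otimes>\<^sub>M (\<mu> \<Otimes>\<^sub>M \<mu>)"

text \<open>The preimage of \<open>T\<close> under reduction, written as a union of boxes so that
  its measure is a sum of products.\<close>

definition residue_triples :: "('a set \<times> 'a set \<times> 'a set) set \<Rightarrow> ('a \<times> 'a \<times> 'a) set" where
  "residue_triples T = (\<Union>(A, B, C)\<in>T. A \<times> B \<times> C)"

lemma mem_residue_triples:
  assumes "T \<subseteq> carrier kf \<times> carrier kf \<times> carrier kf"
  shows "(a, b, c) \<in> residue_triples T \<longleftrightarrow>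
    a \<in> carrier VR \<and> b \<in> carrier VR \<and> c \<in> carrier VR \<and> (res a, res b, res c) \<in> T"
proof
  assume "(a, b, c) \<in> residue_triples T"
  then obtain A B C where *: "(A, B, C) \<in> T" "a \<in> A" "b \<in> B" "c \<in> C"
    unfolding residue_triples_def by blast
  hence "A \<in> carrier kf" "B \<in> carrier kf" "C \<in> carrier kf" using assms by auto
  thus "a \<in> carrier VR \<and> b \<in> carrier VR \<and> c \<in> carrier VR \<and> (res a, res b, res c) \<in> T"
    using * mem_res_class_iff by metis
next
  assume *: "a \<in> carrier VR \<and> b \<in> carrier VR \<and> c \<in> carrier VR \<and> (res a, res b, res c) \<in> T"
  hence "a \<in> res a" "b \<in> res b" "c \<in> res c" using res_as_fibre by blast+
  thus "(a, b, c) \<in> residue_triples T" unfolding residue_triples_def using * by blast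
qed

lemma residue_box_measurable:
  "\<lbrakk>A \<in> carrier kf; B \<in> carrier kf; C \<in> carrier kf\<rbrakk> \<Longrightarrow> A \<times> B \<times> C \<in> sets triple_measure"
  by (intro pair_measureI res_class_measurable)

lemma residue_triples_measurable:
  assumes T: "T \<subseteq> carrier kf \<times> carrier kf \<times> carrier kf"
  shows "residue_triples T \<in> sets triple_measure"
proof -
  have "finite T" using finite_subset[OF T] finite_res_field by auto
  thus ?thesis unfolding residue_triples_def
    using residue_box_measurable T by (intro sets.finite_UN) auto
qed

lemma measure_residue_triples:
  assumes T: "T \<subseteq> carrier kf \<times> carrier kf \<times> carrier kf"
  shows "measure triple_measure (residue_triples T) = real (card T) / real (card (carrier kf)) ^ 3"
proof -
  interpret P2: pair_prob_space \<mu> \<mu> ..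
  interpret P3: pair_prob_space \<mu> "\<mu> \<Otimes>\<^sub>M \<mu>" ..
  have fin: "finite T" using finite_subset[OF T] finite_res_field by auto
  have box: "measure triple_measure (A \<times> B \<times> C) = (1 / real (card (carrier kf))) ^ 3"
    if "A \<in> carrier kf" "B \<in> carrier kf" "C \<in> carrier kf" for A B C
  proof -
    have "measure triple_measure (A \<times> B \<times> C) = measure \<mu> A * measure (\<mu> \<Otimes>\<^sub>M \<mu>) (B \<times> C)"
      unfolding measure_def
      by (subst P2.P.emeasure_pair_measure_Times) (auto intro!: res_class_measurable pair_measureI that simp: enn2real_mult)
    also have "measure (\<mu> \<Otimes>\<^sub>M \<mu>) (B \<times> C) = measure \<mu> B * measure \<mu> C"
      unfolding measure_def
      by (subst emeasure_pair_measure_Times) (auto intro!: res_class_measurable that simp: enn2real_mult)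
    finally show ?thesis using that measure_res_class by (simp add: power3_eq_cube)
  qed
  have "measure triple_measure (residue_triples T) = (\<Sum>t\<in>T. measure triple_measure (case t of (A, B, C) \<Rightarrow> A \<times> B \<times> C))"
    unfolding residue_triples_def
  proof (rule P3.P.finite_measure_finite_Union[OF fin])
    show "(\<lambda>t. case t of (A, B, C) \<Rightarrow> A \<times> B \<times> C) ` T \<subseteq> sets triple_measure"
      using residue_box_measurable T by auto
    show "disjoint_family_on (\<lambda>t. case t of (A, B, C) \<Rightarrow> A \<times> B \<times> C) T"
      unfolding disjoint_family_on_def
    proof (intro ballI impI)
      fix s t assume st: "s \<in> T" "t \<in> T" "s \<noteq> t"
      obtain A B C where s: "s = (A, B, C)" by (cases s) auto
      obtain A' B' C' where t: "t = (A', B', C')" by (cases t) auto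
      have cls: "A \<in> carrier kf" "B \<in> carrier kf" "C \<in> carrier kf"
        "A' \<in> carrier kf" "B' \<in> carrier kf" "C' \<in> carrier kf"
        using st s t T by auto
      have "A \<inter> A' = {} \<or> B \<inter> B' = {} \<or> C \<inter> C' = {}"
        using st(3) s t cls res_class_disjoint by blast
      thus "(case s of (A, B, C) \<Rightarrow> A \<times> B \<times> C) \<inter> (case t of (A, B, C) \<Rightarrow> A \<times> B \<times> C) = {}"
        unfolding s t by auto
    qed
  qed
  also have "\<dots> = (\<Sum>t\<in>T. (1 / real (card (carrier kf))) ^ 3)"
    using T box by (intro sum.cong) auto
  finally show ?thesis by (simp add: power_one_over)
qed

text \<open>The product sigma-algebra is generated by boxes, so an open set has to be a countable
  union of them. For every k, take the boxes inside \<open>W\<close> whose sides are balls of radius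
  p^-k with centres in a finite net.\<close>

lemma open_triples_measurable:
  assumes W: "W \<subseteq> carrier VR \<times> carrier VR \<times> carrier VR"
    and op: "\<And>a b c. (a, b, c) \<in> W \<Longrightarrow> \<exists>e>0. \<forall>a'\<in>carrier VR. \<forall>b'\<in>carrier VR. \<forall>c'\<in>carrier VR.
      v (a' \<ominus> a) < e \<longrightarrow> v (b' \<ominus> b) < e \<longrightarrow> v (c' \<ominus> c) < e \<longrightarrow> (a', b', c') \<in> W"
  shows "W \<in> sets triple_measure"
proof -
  have "\<exists>T. finite T \<and> T \<subseteq> carrier VR \<and> (\<forall>x\<in>carrier VR. \<exists>t\<in>T. v (x \<ominus> t) < (1 / real p) ^ k)" for k
  proof -
    obtain T where T: "finite T" "T \<subseteq> carrier K" "\<And>t. t \<in> T \<Longrightarrow> v t \<le> 1"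
      "\<And>x. x \<in> carrier K \<Longrightarrow> v x \<le> 1 \<Longrightarrow> \<exists>t\<in>T. v (x \<ominus> t) \<le> (1 / real p) ^ Suc k"
      by (rule finite_net) blast
    \<comment> \<open>The net is one scale finer than the radius, which turns its weak inequality
      into the strict one that defines the balls.\<close>
    have lt: "(1 / real p) ^ Suc k < (1 / real p) ^ k" using p_gt_1 by (intro power_strict_decreasing) auto
    have "\<exists>t\<in>T. v (x \<ominus> t) < (1 / real p) ^ k" if x: "x \<in> carrier VR" for x
    proof -
      obtain t where "t \<in> T" "v (x \<ominus> t) \<le> (1 / real p) ^ Suc k" using T(4)[of x] x by auto
      thus ?thesis using le_less_trans[OF _ lt] by blast
    qed
    moreover have "T \<subseteq> carrier VR" using T(2,3) by auto
    ultimately show ?thesis using T(1) by blast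
  qed
  then obtain T where T: "\<And>k. finite (T k)" "\<And>k. T k \<subseteq> carrier VR"
    "\<And>k x. x \<in> carrier VR \<Longrightarrow> \<exists>t\<in>T k. v (x \<ominus> t) < (1 / real p) ^ k" by metis
  define B where "B = (\<lambda>k t. {y \<in> carrier VR. v (y \<ominus> t) < (1 / real p) ^ k})"
  define I where "I = (\<lambda>k. {(s, t, u). s \<in> T k \<and> t \<in> T k \<and> u \<in> T k \<and> B k s \<times> B k t \<times> B k u \<subseteq> W})"
  have I: "I k \<subseteq> T k \<times> T k \<times> T k" for k by (auto simp: I_def)
  have finI: "finite (I k)" for k using finite_subset[OF I] T(1) by simp
  have Bm: "B k t \<in> sets \<mu>" if "t \<in> T k" for k t
    unfolding B_def using ball_measurable T(2) that p_gt_1 by (meson divide_pos_pos less_trans subsetD zero_less_one zero_less_power)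
  have "W = (\<Union>k. \<Union>(s, t, u)\<in>I k. B k s \<times> B k t \<times> B k u)"
  proof
    show "W \<subseteq> (\<Union>k. \<Union>(s, t, u)\<in>I k. B k s \<times> B k t \<times> B k u)"
    proof
      fix w assume "w \<in> W"
      then obtain a b c where w: "w = (a, b, c)" "(a, b, c) \<in> W" by (cases w) auto
      have abc: "a \<in> carrier VR" "b \<in> carrier VR" "c \<in> carrier VR" using w W by auto
      obtain e where e: "e > 0" "\<And>a' b' c'. \<lbrakk>a' \<in> carrier VR; b' \<in> carrier VR; c' \<in> carrier VR;
        v (a' \<ominus> a) < e; v (b' \<ominus> b) < e; v (c' \<ominus> c) < e\<rbrakk> \<Longrightarrow> (a', b', c') \<in> W" using op[OF w(2)] by blast
      obtain k where k: "(1 / real p) ^ k < e" using real_arch_pow_inv[OF e(1), of "1 / real p"] p_gt_1 by auto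
      obtain s t u where stu: "s \<in> T k" "t \<in> T k" "u \<in> T k"
        "v (a \<ominus> s) < (1 / real p) ^ k" "v (b \<ominus> t) < (1 / real p) ^ k" "v (c \<ominus> u) < (1 / real p) ^ k"
        using T(3)[OF abc(1)] T(3)[OF abc(2)] T(3)[OF abc(3)] by metis
      have near: "v (x' \<ominus> x) < e"
        if "x \<in> carrier VR" "x' \<in> B k y" "v (x \<ominus> y) < (1 / real p) ^ k" "y \<in> T k" for x x' y
      proof -
        have K: "x \<in> carrier K" "x' \<in> carrier K" "y \<in> carrier K" using that T(2) by (auto simp: B_def)
        have "x' \<ominus> x = (x' \<ominus> y) \<ominus> (x \<ominus> y)" using K by algebra
        hence "v (x' \<ominus> x) \<le> max (v (x' \<ominus> y)) (v (x \<ominus> y))" using v_diff[of "x' \<ominus> y" "x \<ominus> y"] K by simp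
        thus ?thesis using that k by (auto simp: B_def)
      qed
      have "B k s \<times> B k t \<times> B k u \<subseteq> W"
      proof safe
        fix a' b' c' assume *: "a' \<in> B k s" "b' \<in> B k t" "c' \<in> B k u"
        show "(a', b', c') \<in> W"
          using e(2)[OF _ _ _ near[OF abc(1) *(1) stu(4,1)] near[OF abc(2) *(2) stu(5,2)] near[OF abc(3) *(3) stu(6,3)]] *
          by (auto simp: B_def)
      qed
      hence "(s, t, u) \<in> I k" using stu by (simp add: I_def)
      moreover have "w \<in> B k s \<times> B k t \<times> B k u" using w abc stu by (auto simp: B_def)
      ultimately show "w \<in> (\<Union>k. \<Union>(s, t, u)\<in>I k. B k s \<times> B k t \<times> B k u)" by blast
    qed
    show "(\<Union>k. \<Union>(s, t, u)\<in>I k. B k s \<times> B k t \<times> B k u) \<subseteq> W" by (auto simp: I_def)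
  qed
  moreover have "(\<Union>k. \<Union>(s, t, u)\<in>I k. B k s \<times> B k t \<times> B k u) \<in> sets triple_measure"
  proof (intro sets.countable_UN image_subsetI sets.finite_UN finI)
    fix k x assume "x \<in> I k"
    thus "(case x of (s, t, u) \<Rightarrow> B k s \<times> B k t \<times> B k u) \<in> sets triple_measure"
      using Bm by (auto simp: I_def intro!: pair_measureI)
  qed
  ultimately show ?thesis by simp
qed

text \<open>The squares are the union of the open set of nonzero squares and the closed set \<open>{0}\<close>.\<close>

lemma square_triples_measurable:
  assumes F: "\<And>a b c. \<lbrakk>a \<in> carrier VR; b \<in> carrier VR; c \<in> carrier VR\<rbrakk> \<Longrightarrow> F a b c \<in> carrier VR"
    and lip: "\<And>a b c a' b' c' e. \<lbrakk>a \<in> carrier VR; b \<in> carrier VR; c \<in> carrier VR;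
      a' \<in> carrier VR; b' \<in> carrier VR; c' \<in> carrier VR;
      v (a' \<ominus> a) < e; v (b' \<ominus> b) < e; v (c' \<ominus> c) < e\<rbrakk> \<Longrightarrow> v (F a' b' c' \<ominus> F a b c) < e"
  shows "{(a, b, c). a \<in> carrier VR \<and> b \<in> carrier VR \<and> c \<in> carrier VR \<and> F a b c \<in> squares VR} \<in> sets triple_measure"
proof -
  define D where "D = (\<lambda>S. {(a, b, c). a \<in> carrier VR \<and> b \<in> carrier VR \<and> c \<in> carrier VR \<and> F a b c \<in> S})"
  \<comment> \<open>The condition on \<open>S\<close> says that its elements tolerate perturbations
    smaller than their own absolute value. With \<open>lip\<close> the preimage of such a set is
    open, with radius \<open>v (F a b c)\<close> at each triple.\<close>
  have D: "D S \<in> sets triple_measure" if S: "\<And>x y. \<lbrakk>x \<in> S; x \<in> carrier VR; y \<in> carrier VR; v (y \<ominus> x) < v x\<rbrakk> \<Longrightarrow> y \<in> S"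
    and S0: "\<zero> \<notin> S" for S
  proof (rule open_triples_measurable)
    show "D S \<subseteq> carrier VR \<times> carrier VR \<times> carrier VR" by (auto simp: D_def)
    fix a b c assume abc: "(a, b, c) \<in> D S"
    hence C: "a \<in> carrier VR" "b \<in> carrier VR" "c \<in> carrier VR" "F a b c \<in> S" by (auto simp: D_def)
    have FV: "F a b c \<in> carrier VR" using F C by blast
    have "v (F a b c) > 0" using C S0 FV v_nonneg[of "F a b c"] v_eq_0_iff[of "F a b c"] by force
    moreover have "(a', b', c') \<in> D S" if "a' \<in> carrier VR" "b' \<in> carrier VR" "c' \<in> carrier VR"
      "v (a' \<ominus> a) < v (F a b c)" "v (b' \<ominus> b) < v (F a b c)" "v (c' \<ominus> c) < v (F a b c)" for a' b' c'
      using S[OF C(4) FV F[OF that(1-3)] lip[OF C(1-3) that]] that by (simp add: D_def)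
    ultimately show "\<exists>e>0. \<forall>a'\<in>carrier VR. \<forall>b'\<in>carrier VR. \<forall>c'\<in>carrier VR.
        v (a' \<ominus> a) < e \<longrightarrow> v (b' \<ominus> b) < e \<longrightarrow> v (c' \<ominus> c) < e \<longrightarrow> (a', b', c') \<in> D S" by blast
  qed
  have 1: "D (squares VR - {\<zero>}) \<in> sets triple_measure"
    using square_near_square[OF odd_p] by (intro D) auto
  have 2: "D (- {\<zero>}) \<in> sets triple_measure"
    by (intro D) (auto simp: minus_eq)
  have "\<zero> \<in> squares VR" by (auto simp: squares_VR intro!: exI[of _ \<zero>])
  \<comment> \<open>The triples with \<open>F a b c = \<zero>\<close> enter as the complement of an
    open set.\<close>
  hence "D (squares VR) = D (squares VR - {\<zero>}) \<union> (space triple_measure - D (- {\<zero>}))"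
    by (auto simp: D_def space_pair_measure space_mu)
  thus ?thesis using 1 2 by (simp add: D_def)
qed

text \<open>Multiplication is nonexpansive on integral elements: the difference of products
  telescopes into two terms, each with an integral factor.\<close>

lemma v_mult_diff_less:
  assumes "a \<in> carrier VR" "b \<in> carrier VR" "a' \<in> carrier VR" "b' \<in> carrier VR" "\<rho> \<in> carrier VR"
    and "v (a' \<ominus> a) < e" "v (b' \<ominus> b) < e"
  shows "v ((a' \<otimes> b' \<oplus> \<rho>) \<ominus> (a \<otimes> b \<oplus> \<rho>)) < e"
proof -
  have K: "a \<in> carrier K" "b \<in> carrier K" "a' \<in> carrier K" "b' \<in> carrier K" "\<rho> \<in> carrier K" using assms by auto
  have "(a' \<otimes> b' \<oplus> \<rho>) \<ominus> (a \<otimes> b \<oplus> \<rho>) = a' \<otimes> (b' \<ominus> b) \<oplus> (a' \<ominus> a) \<otimes> b" using K by algebra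
  moreover have "v (a' \<otimes> (b' \<ominus> b)) \<le> 1 * v (b' \<ominus> b)" "v ((a' \<ominus> a) \<otimes> b) \<le> v (a' \<ominus> a) * 1"
    using assms by (intro v_mult_le; simp)+
  ultimately show ?thesis using v_add[of "a' \<otimes> (b' \<ominus> b)" "(a' \<ominus> a) \<otimes> b"] K assms by simp
qed

lemma mult_add_VR: "\<lbrakk>a \<in> carrier VR; b \<in> carrier VR; \<rho> \<in> carrier VR\<rbrakk> \<Longrightarrow> a \<otimes> b \<oplus> \<rho> \<in> carrier VR"
  using VR.a_closed[of "a \<otimes> b" \<rho>] VR.m_closed[of a b] by simp

section \<open>The density over a single field\<close>

theorem diop3_bound:
  assumes r: "\<not> int p dvd r"
  shows "\<bar>diop3 r VR \<mu> - 1 / 8\<bar> \<le> 7 / real p"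
proof -
  define \<rho> where "\<rho> = \<guillemotleft>r\<guillemotright>"
  have \<rho>: "\<rho> \<in> carrier VR" "v \<rho> = 1" using v_of_int_coprime[OF r] by (auto simp: \<rho>_def)
  define R where "R = res \<rho>"
  have R: "R \<in> carrier kf" "R \<noteq> \<zero>\<^bsub>kf\<^esub>"
    using \<rho> res_eq_zero_iff[OF \<rho>(1)] by (auto simp: R_def carrier_res_field)
  define q where "q = real (card (carrier kf))"
  define D where "D = {(a, b, c). a \<in> carrier VR \<and> b \<in> carrier VR \<and> c \<in> carrier VR \<and>
     a \<otimes> b \<oplus> \<rho> \<in> squares VR \<and> b \<otimes> c \<oplus> \<rho> \<in> squares VR \<and> a \<otimes> c \<oplus> \<rho> \<in> squares VR}"
  define G where "G = {(a, b, c). a \<in> carrier kf \<and> b \<in> carrier kf \<and> c \<in> carrier kf \<and>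
     a \<otimes>\<^bsub>kf\<^esub> b \<oplus>\<^bsub>kf\<^esub> R \<in> k.nonzero_squares \<and> b \<otimes>\<^bsub>kf\<^esub> c \<oplus>\<^bsub>kf\<^esub> R \<in> k.nonzero_squares \<and>
     a \<otimes>\<^bsub>kf\<^esub> c \<oplus>\<^bsub>kf\<^esub> R \<in> k.nonzero_squares}"
  define Z where "Z = {(a, b, c). a \<in> carrier kf \<and> b \<in> carrier kf \<and> c \<in> carrier kf \<and>
     (a \<otimes>\<^bsub>kf\<^esub> b \<oplus>\<^bsub>kf\<^esub> R = \<zero>\<^bsub>kf\<^esub> \<or> b \<otimes>\<^bsub>kf\<^esub> c \<oplus>\<^bsub>kf\<^esub> R = \<zero>\<^bsub>kf\<^esub> \<or> a \<otimes>\<^bsub>kf\<^esub> c \<oplus>\<^bsub>kf\<^esub> R = \<zero>\<^bsub>kf\<^esub>)}"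
  have GZ: "G \<subseteq> carrier kf \<times> carrier kf \<times> carrier kf" "Z \<subseteq> carrier kf \<times> carrier kf \<times> carrier kf"
    by (auto simp: G_def Z_def)
  have resF: "res (a \<otimes> b \<oplus> \<rho>) = res a \<otimes>\<^bsub>kf\<^esub> res b \<oplus>\<^bsub>kf\<^esub> R" if "a \<in> carrier VR" "b \<in> carrier VR" for a b
    using that \<rho> VR.m_closed[of a b] by (simp add: res_add res_mult R_def)
  have rescarrier: "res a \<in> carrier kf" if "a \<in> carrier VR" for a using that by (simp add: carrier_res_field)
  \<comment> \<open>A nonzero residue decides whether a value is a square, a vanishing one does not.
    Hence \<open>G\<close> bounds \<open>D\<close> from below, and from above once \<open>Z\<close>
    absorbs the undecided triples.\<close>
  have lower: "residue_triples G \<subseteq> D"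
  proof safe
    fix a b c assume "(a, b, c) \<in> residue_triples G"
    hence C: "a \<in> carrier VR" "b \<in> carrier VR" "c \<in> carrier VR" and g: "(res a, res b, res c) \<in> G"
      using mem_residue_triples[OF GZ(1)] by auto
    have sq: "x \<otimes> y \<oplus> \<rho> \<in> squares VR"
      if "x \<in> carrier VR" "y \<in> carrier VR" "res x \<otimes>\<^bsub>kf\<^esub> res y \<oplus>\<^bsub>kf\<^esub> R \<in> k.nonzero_squares" for x y
      using square_iff_res_square[OF odd_p mult_add_VR[OF that(1,2) \<rho>(1)]] resF[OF that(1,2)] that(3)
      by (auto simp: k.nonzero_squares_def)
    show "(a, b, c) \<in> D" using C g sq by (auto simp: D_def G_def)
  qed
  have upper: "D \<subseteq> residue_triples G \<union> residue_triples Z"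
  proof safe
    fix a b c assume d: "(a, b, c) \<in> D" and nz: "(a, b, c) \<notin> residue_triples Z"
    hence C: "a \<in> carrier VR" "b \<in> carrier VR" "c \<in> carrier VR" by (auto simp: D_def)
    have nz': "(res a, res b, res c) \<notin> Z" using nz mem_residue_triples[OF GZ(2)] C by blast
    have sq: "res x \<otimes>\<^bsub>kf\<^esub> res y \<oplus>\<^bsub>kf\<^esub> R \<in> k.nonzero_squares"
      if "x \<in> carrier VR" "y \<in> carrier VR" "x \<otimes> y \<oplus> \<rho> \<in> squares VR" "res x \<otimes>\<^bsub>kf\<^esub> res y \<oplus>\<^bsub>kf\<^esub> R \<noteq> \<zero>\<^bsub>kf\<^esub>" for x y
      using square_iff_res_square[OF odd_p mult_add_VR[OF that(1,2) \<rho>(1)]] resF[OF that(1,2)] that(3,4) by simp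
    have "(res a, res b, res c) \<in> G"
      using d nz' C rescarrier sq by (auto simp: D_def G_def Z_def)
    thus "(a, b, c) \<in> residue_triples G" using mem_residue_triples[OF GZ(1)] C by blast
  qed
  have "D = {(a, b, c). a \<in> carrier VR \<and> b \<in> carrier VR \<and> c \<in> carrier VR \<and> a \<otimes> b \<oplus> \<rho> \<in> squares VR} \<inter>
      {(a, b, c). a \<in> carrier VR \<and> b \<in> carrier VR \<and> c \<in> carrier VR \<and> b \<otimes> c \<oplus> \<rho> \<in> squares VR} \<inter>
      {(a, b, c). a \<in> carrier VR \<and> b \<in> carrier VR \<and> c \<in> carrier VR \<and> a \<otimes> c \<oplus> \<rho> \<in> squares VR}"
    by (auto simp: D_def)
  also have "\<dots> \<in> sets triple_measure"
    by (intro sets.Int square_triples_measurable mult_add_VR v_mult_diff_less) (use \<rho> in auto)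
  finally have Dm: "D \<in> sets triple_measure" .
  interpret P2: pair_prob_space \<mu> \<mu> ..
  interpret P3: pair_prob_space \<mu> "\<mu> \<Otimes>\<^sub>M \<mu>" ..
  have "measure triple_measure (residue_triples G) \<le> measure triple_measure D"
    by (rule P3.P.finite_measure_mono[OF lower Dm])
  moreover have "measure triple_measure D \<le> measure triple_measure (residue_triples G \<union> residue_triples Z)"
    by (rule P3.P.finite_measure_mono[OF upper]) (intro sets.Un residue_triples_measurable GZ)
  moreover have "\<dots> \<le> measure triple_measure (residue_triples G) + measure triple_measure (residue_triples Z)"
    by (intro measure_Un_le residue_triples_measurable GZ)
  ultimately have D_bounds: "real (card G) / q ^ 3 \<le> measure triple_measure D" "measure triple_measure D \<le> real (card G) / q ^ 3 + real (card Z) / q ^ 3"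
    unfolding q_def measure_residue_triples[OF GZ(1)] measure_residue_triples[OF GZ(2)] by linarith+
  have qp: "real p \<le> q" using card_res_field_ge by (simp add: q_def)
  hence q0: "q > 0" using p_gt_1 by simp
  have "\<bar>8 * real (card G) - q ^ 3\<bar> \<le> 26 * q ^ 2"
    unfolding G_def q_def by (rule k.card_square_triples[OF R])
  hence "\<bar>8 * real (card G) - q ^ 3\<bar> / (8 * q ^ 3) \<le> 26 * q ^ 2 / (8 * q ^ 3)"
    using q0 by (intro divide_right_mono) auto
  moreover have "real (card G) / q ^ 3 - 1 / 8 = (8 * real (card G) - q ^ 3) / (8 * q ^ 3)"
    using q0 by (simp add: field_simps)
  \<comment> \<open>The character sums contribute 26 / 8 = 13 / 4 and \<open>Z\<close> contributes
    3, both over q; the total 25 / 4 is rounded up to 7.\<close>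
  moreover have "26 * q ^ 2 / (8 * q ^ 3) = (13 / 4) / q"
    using q0 by (simp add: numeral_2_eq_2 numeral_3_eq_3)
  ultimately have "\<bar>real (card G) / q ^ 3 - 1 / 8\<bar> \<le> (13 / 4) / q"
    using q0 by (simp add: abs_divide)
  moreover have "real (card Z) \<le> 3 * q ^ 2"
    unfolding Z_def q_def by (rule k.card_zero_triples_le[OF R])
  hence "real (card Z) / q ^ 3 \<le> 3 / q"
    using q0 by (simp add: field_simps numeral_2_eq_2 numeral_3_eq_3)
  moreover have "(13 / 4) / q + 3 / q \<le> 7 / q" using q0 by (simp add: field_simps)
  moreover have "7 / q \<le> 7 / real p" using qp q0 p_gt_1 by (intro divide_left_mono) auto
  ultimately have "\<bar>measure triple_measure D - 1 / 8\<bar> \<le> 7 / real p" using D_bounds by linarith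
  thus ?thesis using VR_of_int[of r] by (simp add: diop3_def D_def \<rho>_def)
qed

end

section \<open>The asymptotic statement along a sequence of fields\<close>

theorem theorem7p3:
  fixes r :: int
  assumes "r \<noteq> 0"
  shows "\<exists>C::real. \<forall>(K :: nat \<Rightarrow> 'a ring) (p :: nat \<Rightarrow> nat)
           (\<phi> :: nat \<Rightarrow> (nat \<Rightarrow> rat) set \<Rightarrow> 'a) (v :: nat \<Rightarrow> 'a \<Rightarrow> real) (\<mu> :: nat \<Rightarrow> 'a measure).
           (\<forall>i. padic_field (K i) (p i) (\<phi> i) (v i)) \<longrightarrow>
           (\<forall>i. normalized_Haar_measure (valuation_ring (K i) (v i)) (v i) (\<mu> i)) \<longrightarrow>
           filterlim p at_top sequentially \<longrightarrow>
           (\<forall>\<^sub>F i in sequentially.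
              \<bar>diop3 r (valuation_ring (K i) (v i)) (\<mu> i) - 1 / 8\<bar> \<le> C / real (p i))"
proof (intro exI[of _ 7] allI impI)
  fix K :: "nat \<Rightarrow> 'a ring" and p :: "nat \<Rightarrow> nat" and \<phi> :: "nat \<Rightarrow> (nat \<Rightarrow> rat) set \<Rightarrow> 'a"
    and v :: "nat \<Rightarrow> 'a \<Rightarrow> real" and \<mu> :: "nat \<Rightarrow> 'a measure"
  assume F: "\<forall>i. padic_field (K i) (p i) (\<phi> i) (v i)"
    and H: "\<forall>i. normalized_Haar_measure (valuation_ring (K i) (v i)) (v i) (\<mu> i)"
    and lim: "filterlim p at_top sequentially"
  \<comment> \<open>Beyond this threshold the prime is odd and exceeds the absolute value of the
    nonzero integer \<open>r\<close>, so it does not divide \<open>r\<close>. Only the threshold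
    depends on \<open>r\<close>; the constant 7 is uniform.\<close>
  have "\<forall>\<^sub>F i in sequentially. Suc (max 2 (nat \<bar>r\<bar>)) \<le> p i"
    using lim unfolding filterlim_at_top by blast
  thus "\<forall>\<^sub>F i in sequentially. \<bar>diop3 r (valuation_ring (K i) (v i)) (\<mu> i) - 1 / 8\<bar> \<le> 7 / real (p i)"
  proof eventually_elim
    case (elim i)
    interpret haar_padic_field "K i" "p i" "\<phi> i" "v i" "\<mu> i"
      using F H elim by (intro haar_padic_field.intro haar_padic_field_axioms.intro) auto
    have "\<not> int (p i) dvd r" using elim assms zdvd_imp_le[of "int (p i)" "\<bar>r\<bar>"] by auto
    thus ?case by (rule diop3_bound)
  qed
qed

end
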